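(* (a) Let $\Delta$ be a connected stable digraph with vertex set $V$ and let $k$ be a positive integer. Assume that whenever $(v,w)$ is an arc in $\Delta$ then $(w,v)$ is also an arc in $\Delta$, and that $\mathrm{CDHC}(\Delta)$ is arc-transitive. Set $\Gamma=\mathbb{Z}(\Delta,k)$, let $s$ be the automorphism of $\Gamma$ given by $(i;x_0,\dots,x_{k-2},x_{k-1})^s=(i+1;x_{k-1},x_0,\dots,x_{k-2})$, and set $N=\langle s^q\rangle$ where $q=lk$ for some integer $l>1$. Then $\Gamma/N$ is a sharply $k$-arc-transitive finite digraph. (b) Let $\Gamma=\mathbb{Z}(\Theta_n,k)$, where $3\le n<\infty$ and $k\ge 1$, let $s$ be the automorphism of $\Gamma$ given by $(i;x_0,\dots,x_{k-2},x_{k-1})^s=(i+1;x_{k-1},x_0,\dots,x_{k-2})$, and set $N=\langle s^q\rangle$ where $q$ is some number that is divisible by $kn$. Then $\Gamma/N$ is a sharply $k$-arc-transitive finite digraph.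
   Context: A digraph $\Gamma$ is a pair $(\mathrm V\Gamma,\mathrm E\Gamma)$ with $\mathrm E\Gamma\subseteq \mathrm V\Gamma\times \mathrm V\Gamma$ the set of arcs (loops are allowed, and both $(v,w)$ and $(w,v)$ may be arcs). A digraph is connected if its underlying undirected graph is connected. A $k$-arc is a sequence $(v_0,\dots,v_k)$ of vertices with $(v_{i-1},v_i)$ an arc for $1\le i\le k$. $\Gamma$ is $k$-arc-transitive if $\mathrm{Aut}(\Gamma)$ acts transitively on the set of $k$-arcs; arc-transitive means $1$-arc-transitive; sharply $k$-arc-transitive means $k$-arc-transitive but not $(k+1)$-arc-transitive. For a digraph $\Delta$ with vertex set $V$ and a positive integer $k$, $\mathbb{Z}(\Delta,k)$ is the digraph with vertex set $\mathbb{Z}\times V^k$ in which the out-neighbours of $(i;v_0,\dots,v_{k-1})$ are the vertices $(i+1;w_0,\dots,w_{k-1})$ such that $v_j=w_j$ if $j\not\equiv i \pmod k$, and $(v_j,w_j)\in \mathrm E\Delta$ if $j\equiv i\pmod k$. The canonical double half-cover $\mathrm{CDHC}(\Delta)$ is the digraph with vertex set $V\times\{0,1\}$ whose arcs are exactly the pairs $((x,0),(y,1))$ with $(x,y)\in \mathrm E\Delta$. A digraph $\Delta$ is stable if for each $x\in \mathrm V\Delta$ the pair $\{(x,0),(x,1)\}$ is a block of imprimitivity of $\mathrm{Aut}(\mathrm{CDHC}(\Delta))$, where a set $A$ is a block of imprimitivity for a group $G$ if for every $g\in G$ either $A^g=A$ or $A\cap A^g=\emptyset$. For an integer $n\geq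 3$, $\Theta_n$ is the directed cycle of length $n$ with a loop attached at every vertex (vertex set $\mathbb{Z}_n$, arcs $(x,x)$ and $(x,x+1)$). For a group $N$ of automorphisms of $\Gamma$, the quotient digraph $\Gamma/N$ has as vertices the $N$-orbits on $\mathrm V\Gamma$, with $(A,B)$ an arc if and only if there are $a\in A$, $b\in B$ with $(a,b)\in \mathrm E\Gamma$.
   Formalization: In (a) some vertex of Δ is assumed to have two distinct out-neighbours (this excludes only K_1, K_1 with a loop and K_2, where the claim fails), and Γ/N is claimed finite only when V is finite; in (b) q is taken positive. *)

theory Defs
  imports
    "Graph_Theory.Digraph_Component"
    "HOL-Algebra.Bij"
    "HOL-Algebra.Generated_Groups"
    "HOL-Number_Theory.Cong"
begin

text \<open>
  Digraphs are values of type \<^typ>\<open>'a pair_pre_digraph\<close> satisfying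
  \<^locale>\<open>pair_wf_digraph\<close>: a vertex set together with an arbitrary set of ordered
  pairs of vertices as arcs, loops included.
\<close>

definition digraph_aut :: "'a pair_pre_digraph \<Rightarrow> ('a \<Rightarrow> 'a) monoid" where
  "digraph_aut \<Gamma> =
     (BijGroup (pverts \<Gamma>)) \<lparr>carrier :=
        {f \<in> Bij (pverts \<Gamma>). \<forall>u\<in>pverts \<Gamma>. \<forall>v\<in>pverts \<Gamma>.
           (u, v) \<in> parcs \<Gamma> \<longleftrightarrow> (f u, f v) \<in> parcs \<Gamma>}\<rparr>"

definition k_arcs :: "nat \<Rightarrow> 'a pair_pre_digraph \<Rightarrow> 'a list set" where
  "k_arcs k \<Gamma> =
     {p. length p = Suc k \<and> set p \<subseteq> pverts \<Gamma> \<and> (\<forall>i<k. (p ! i, p ! Suc i) \<in> parcs \<Gamma>)}"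

definition k_arc_transitive :: "nat \<Rightarrow> 'a pair_pre_digraph \<Rightarrow> bool" where
  "k_arc_transitive k \<Gamma> \<longleftrightarrow>
     (\<forall>p\<in>k_arcs k \<Gamma>. \<forall>p'\<in>k_arcs k \<Gamma>. \<exists>g\<in>carrier (digraph_aut \<Gamma>). map g p = p')"

abbreviation arc_transitive :: "'a pair_pre_digraph \<Rightarrow> bool" where
  "arc_transitive \<equiv> k_arc_transitive 1"

definition sharply_k_arc_transitive :: "nat \<Rightarrow> 'a pair_pre_digraph \<Rightarrow> bool" where
  "sharply_k_arc_transitive k \<Gamma> \<longleftrightarrow> k_arc_transitive k \<Gamma> \<and> \<not> k_arc_transitive (Suc k) \<Gamma>"

text \<open>Elements of $V^k$ are lists of length \<open>k\<close> with entries in \<open>V\<close>.\<close>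

definition Z_digraph :: "'a pair_pre_digraph \<Rightarrow> nat \<Rightarrow> (int \<times> 'a list) pair_pre_digraph" where
  "Z_digraph \<Delta> k =
     (let X = {x. length x = k \<and> set x \<subseteq> pverts \<Delta>} in
      \<lparr>pverts = UNIV \<times> X,
       parcs = {((i, v), (i + 1, w)) | i v w. v \<in> X \<and> w \<in> X \<and>
          (\<forall>j<k. if [int j = i] (mod int k) then (v ! j, w ! j) \<in> parcs \<Delta>
                 else v ! j = w ! j)}\<rparr>)"

definition Z_shift :: "'a pair_pre_digraph \<Rightarrow> nat \<Rightarrow> int \<times> 'a list \<Rightarrow> int \<times> 'a list" where
  "Z_shift \<Delta> k =
     restrict (\<lambda>(i, x). (i + 1, last x # butlast x)) (pverts (Z_digraph \<Delta> k))"

definition CDHC :: "'a pair_pre_digraph \<Rightarrow> ('a \<times> nat) pair_pre_digraph" where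
  "CDHC \<Delta> =
     \<lparr>pverts = pverts \<Delta> \<times> {0, 1}, parcs = {((x, 0), (y, 1)) | x y. (x, y) \<in> parcs \<Delta>}\<rparr>"

definition block_of_imprimitivity :: "('a \<Rightarrow> 'a) set \<Rightarrow> 'a set \<Rightarrow> bool" where
  "block_of_imprimitivity G A \<longleftrightarrow> (\<forall>g\<in>G. g ` A = A \<or> A \<inter> g ` A = {})"

definition stable :: "'a pair_pre_digraph \<Rightarrow> bool" where
  "stable \<Delta> \<longleftrightarrow>
     (\<forall>x\<in>pverts \<Delta>.
        block_of_imprimitivity (carrier (digraph_aut (CDHC \<Delta>))) {(x, 0), (x, 1)})"

definition Theta :: "nat \<Rightarrow> nat pair_pre_digraph" where
  "Theta n =
     \<lparr>pverts = {0..<n}, parcs = {(x, y). x < n \<and> (y = x \<or> y = (x + 1) mod n)}\<rparr>"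

definition orbit_of :: "('a \<Rightarrow> 'a) set \<Rightarrow> 'a \<Rightarrow> 'a set" where
  "orbit_of N v = {g v | g. g \<in> N}"

definition quotient_digraph ::
    "'a pair_pre_digraph \<Rightarrow> ('a \<Rightarrow> 'a) set \<Rightarrow> 'a set pair_pre_digraph" where
  "quotient_digraph \<Gamma> N =
     \<lparr>pverts = orbit_of N ` pverts \<Gamma>,
      parcs = {(A, B). A \<in> orbit_of N ` pverts \<Gamma> \<and> B \<in> orbit_of N ` pverts \<Gamma> \<and>
                 (\<exists>a\<in>A. \<exists>b\<in>B. (a, b) \<in> parcs \<Gamma>)}\<rparr>"

text \<open>The group $\langle s^q\rangle$ for $s$ the shift of \<^term>\<open>Z_digraph \<Delta> k\<close>.\<close>

definition shift_power_group ::
    "'a pair_pre_digraph \<Rightarrow> nat \<Rightarrow> nat \<Rightarrow> (int \<times> 'a list \<Rightarrow> int \<times> 'a list) set" where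
  "shift_power_group \<Delta> k q =
     (let A = digraph_aut (Z_digraph \<Delta> k) in generate A {Z_shift \<Delta> k [^]\<^bsub>A\<^esub> q})"

lemma group_digraph_aut: "group (digraph_aut \<Gamma>)"
proof -
  let ?S = "pverts \<Gamma>"
  let ?H = "carrier (digraph_aut \<Gamma>)"
  have H: "?H = {f \<in> Bij ?S. \<forall>u\<in>?S. \<forall>v\<in>?S. (u, v) \<in> parcs \<Gamma> \<longleftrightarrow> (f u, f v) \<in> parcs \<Gamma>}"
    by (simp add: digraph_aut_def)
  have "subgroup ?H (BijGroup ?S)"
  proof (rule group.subgroupI[OF group_BijGroup])
    show "?H \<subseteq> carrier (BijGroup ?S)"
      by (auto simp: H BijGroup_def)
    have "(\<lambda>x\<in>?S. x) \<in> ?H"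
      by (auto simp: H id_Bij)
    then show "?H \<noteq> {}"
      by blast
  next
    fix f assume f: "f \<in> ?H"
    then have fB: "f \<in> Bij ?S"
      by (simp add: H)
    then have bij: "bij_betw f ?S ?S"
      by (simp add: Bij_def)
    have inv: "inv_into ?S f u \<in> ?S" "f (inv_into ?S f u) = u" if "u \<in> ?S" for u
      using that bij by (auto simp: bij_betw_def inv_into_into f_inv_into_f)
    show "inv\<^bsub>BijGroup ?S\<^esub> f \<in> ?H"
      using f inv by (auto simp: inv_BijGroup[OF fB] H restrict_inv_into_Bij)
  next
    fix f g assume "f \<in> ?H" "g \<in> ?H"
    moreover have "h u \<in> ?S" if "h \<in> Bij ?S" "u \<in> ?S" for h u
      using that by (auto simp: Bij_def bij_betw_def)
    ultimately show "f \<otimes>\<^bsub>BijGroup ?S\<^esub> g \<in> ?H"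
      by (auto simp: H BijGroup_def compose_Bij compose_eq)
  qed
  then have "group ((BijGroup ?S)\<lparr>carrier := ?H\<rparr>)"
    by (rule subgroup.subgroup_is_group[OF _ group_BijGroup])
  then show ?thesis
    by (simp add: digraph_aut_def)
qed

lemma Z_shift_in_aut:
  assumes "k > 0"
  shows "Z_shift \<Delta> k \<in> carrier (digraph_aut (Z_digraph \<Delta> k))"
proof -
  define X where "X = {x. length x = k \<and> set x \<subseteq> pverts \<Delta>}"
  have V: "pverts (Z_digraph \<Delta> k) = UNIV \<times> X"
    by (simp add: Z_digraph_def Let_def X_def)
  let ?r = "\<lambda>x :: 'a list. last x # butlast x"
  have ne: "x \<noteq> []" if "x \<in> X" for x
    using that assms by (auto simp: X_def)
  have rX: "?r x \<in> X" if "x \<in> X" for x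
    using ne[OF that] that in_set_butlastD[of _ x] by (auto simp: X_def)
  have shift: "Z_shift \<Delta> k (i, x) = (i + 1, ?r x)" if "x \<in> X" for i x
    using that by (simp add: Z_shift_def V)
  have nth: "?r x ! (Suc j mod k) = x ! j" if x: "x \<in> X" and j: "j < k" for x j
  proof (cases "Suc j = k")
    case True
    then show ?thesis
      using ne[OF x] x by (auto simp: X_def last_conv_nth)
  next
    case False
    then show ?thesis
      using x j by (auto simp: X_def nth_butlast)
  qed
  have bij_k: "bij_betw (\<lambda>j. Suc j mod k) {..<k} {..<k}"
  proof -
    have "inj_on (\<lambda>j. Suc j mod k) {..<k}"
      by (auto simp: inj_on_def mod_Suc split: if_splits)
    moreover have "(\<lambda>j. Suc j mod k) ` {..<k} \<subseteq> {..<k}"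
      using assms by auto
    ultimately show ?thesis
      by (simp add: bij_betw_def endo_inj_surj)
  qed
  have all_k: "(\<forall>j<k. P j) \<longleftrightarrow> (\<forall>j<k. P (Suc j mod k))" for P
  proof -
    have "(\<forall>j\<in>{..<k}. P j) \<longleftrightarrow> (\<forall>j\<in>(\<lambda>j. Suc j mod k) ` {..<k}. P j)"
      by (simp only: bij_betw_imp_surj_on[OF bij_k])
    also have "\<dots> \<longleftrightarrow> (\<forall>j\<in>{..<k}. P (Suc j mod k))"
      by (rule ball_simps)
    finally show ?thesis
      by (simp only: Ball_def lessThan_iff)
  qed
  have cong: "[int (Suc j mod k) = i + 1] (mod int k) \<longleftrightarrow> [int j = i] (mod int k)" for i j
  proof -
    have "[int (Suc j mod k) = i + 1] (mod int k) \<longleftrightarrow> [int j + 1 = i + 1] (mod int k)"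
      by (simp add: cong_def zmod_int add.commute)
    then show ?thesis
      by (simp add: cong_add_rcancel)
  qed
  have arc: "((i, v), (i', w)) \<in> parcs (Z_digraph \<Delta> k) \<longleftrightarrow> i' = i + 1 \<and>
      (\<forall>j<k. if [int j = i] (mod int k) then (v ! j, w ! j) \<in> parcs \<Delta> else v ! j = w ! j)"
    if "v \<in> X" "w \<in> X" for i i' v w
    using that by (auto simp: Z_digraph_def Let_def X_def)
  have arcs: "((i, v), (i', w)) \<in> parcs (Z_digraph \<Delta> k) \<longleftrightarrow>
      (Z_shift \<Delta> k (i, v), Z_shift \<Delta> k (i', w)) \<in> parcs (Z_digraph \<Delta> k)"
    if v: "v \<in> X" and w: "w \<in> X" for i i' v w
  proof -
    have "(\<forall>j<k. if [int j = i + 1] (mod int k) then (?r v ! j, ?r w ! j) \<in> parcs \<Delta>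
              else ?r v ! j = ?r w ! j) \<longleftrightarrow>
          (\<forall>j<k. if [int j = i] (mod int k) then (v ! j, w ! j) \<in> parcs \<Delta> else v ! j = w ! j)"
      by (subst all_k) (use nth[OF v] nth[OF w] cong in auto)
    moreover have "i' + 1 = i + 1 + 1 \<longleftrightarrow> i' = i + 1"
      by auto
    ultimately show ?thesis
      unfolding shift[OF v] shift[OF w] arc[OF v w] arc[OF rX[OF v] rX[OF w]] by (simp only:)
  qed
  have "bij_betw (Z_shift \<Delta> k) (UNIV \<times> X) (UNIV \<times> X)"
  proof (rule bij_betw_byWitness[where f' = "\<lambda>(i, x). (i - 1, tl x @ [hd x])"])
    show "\<forall>a\<in>UNIV \<times> X. (\<lambda>(i, x). (i - 1, tl x @ [hd x])) (Z_shift \<Delta> k a) = a"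
      using ne by (auto simp: shift)
    have tX: "tl x @ [hd x] \<in> X" if "x \<in> X" for x
      using ne[OF that] that by (cases x) (auto simp: X_def)
    show "\<forall>a\<in>UNIV \<times> X. Z_shift \<Delta> k ((\<lambda>(i, x). (i - 1, tl x @ [hd x])) a) = a"
      using ne by (auto simp: shift tX)
    show "Z_shift \<Delta> k ` (UNIV \<times> X) \<subseteq> UNIV \<times> X"
      using rX by (auto simp: shift)
    show "(\<lambda>(i, x). (i - 1, tl x @ [hd x])) ` (UNIV \<times> X) \<subseteq> UNIV \<times> X"
      using tX by auto
  qed
  then have "Z_shift \<Delta> k \<in> Bij (UNIV \<times> X)"
    by (simp add: Bij_def Z_shift_def V)
  then show ?thesis
    using arcs by (auto simp: digraph_aut_def V)
qed

end

theory Submission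
  imports Defs "HOL-Combinatorics.Transposition"
begin

text \<open>
  In a walk of \<open>\<int>(\<Delta>, k)\<close> the coordinates are changed cyclically, one at a time, so a
  \<open>k\<close>-arc amounts to its starting time together with \<open>k\<close> arcs of \<open>\<Delta>\<close>, one for each
  coordinate. A family \<open>h c\<close> of permutations of the vertices such that \<open>(h c, h (c + 1))\<close>
  is an automorphism of the double half-cover for every \<open>c\<close> acts on one coordinate, \<open>h c\<close>
  being used after \<open>c\<close> changes; it descends to the quotient if it has period \<open>q / k\<close>. For
  \<open>\<Theta>\<^sub>n\<close> rotations and reflections provide such families.

  For an undirected stable \<open>\<Delta>\<close> a constant family \<open>h\<close> is needed, that is, an automorphism of
  \<open>\<Delta>\<close>. Two components of an automorphism \<open>(f, g)\<close> of the double half-cover that agree at one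
  vertex agree at its neighbours, hence everywhere; so vertex stabilizers consist of
  automorphisms of \<open>\<Delta>\<close>. As \<open>\<Delta>\<close> is not bipartite, these stabilizers already
  generate a group that is transitive on arcs.

  On \<open>(k + 1)\<close>-arcs the first coordinate runs through a 2-arc \<open>v, w, u\<close>. Whether every
  out-neighbour of \<open>v\<close> is an in-neighbour of \<open>u\<close> can be read off from paths of length \<open>k\<close>
  in the quotient, and it depends on the 2-arc.
\<close>

section \<open>Two-fold automorphisms\<close>

text \<open>The pair \<open>(f, g)\<close> is an automorphism of the double half-cover that
  preserves its two layers: \<open>f\<close> acts on the tails \<open>V \<times> {0}\<close> and
  \<open>g\<close> on the heads \<open>V \<times> {1}\<close>.\<close>

definition two_fold :: "'a set \<Rightarrow> ('a \<times> 'a) set \<Rightarrow> ('a \<Rightarrow> 'a) \<Rightarrow> ('a \<Rightarrow> 'a) \<Rightarrow> bool" where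
  "two_fold V E f g \<longleftrightarrow> bij_betw f V V \<and> bij_betw g V V \<and>
     (\<forall>x\<in>V. \<forall>y\<in>V. (x, y) \<in> E \<longleftrightarrow> (f x, g y) \<in> E)"

lemma two_fold_in:
  "two_fold V E f g \<Longrightarrow> x \<in> V \<Longrightarrow> f x \<in> V \<and> g x \<in> V"
  by (auto simp: two_fold_def bij_betw_apply)

lemma two_fold_arc:
  "two_fold V E f g \<Longrightarrow> x \<in> V \<Longrightarrow> y \<in> V \<Longrightarrow> (f x, g y) \<in> E \<longleftrightarrow> (x, y) \<in> E"
  by (auto simp: two_fold_def)

lemma two_fold_swap:
  "sym E \<Longrightarrow> two_fold V E f g \<Longrightarrow> two_fold V E g f"
  unfolding two_fold_def by (meson symE)

lemma two_fold_comp: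
  "two_fold V E f g \<Longrightarrow> two_fold V E f' g' \<Longrightarrow> two_fold V E (f' \<circ> f) (g' \<circ> g)"
  using two_fold_in[of V E f g] unfolding two_fold_def by (auto intro: bij_betw_trans)

lemma two_fold_inv:
  assumes "two_fold V E f g"
  shows "two_fold V E (inv_into V f) (inv_into V g)"
proof -
  have b: "bij_betw f V V" "bij_betw g V V"
    using assms by (auto simp: two_fold_def)
  have "(x, y) \<in> E \<longleftrightarrow> (inv_into V f x, inv_into V g y) \<in> E" if "x \<in> V" "y \<in> V" for x y
    using two_fold_arc[OF assms, of "inv_into V f x" "inv_into V g y"] that b
    by (simp add: bij_betw_inv_into_right bij_betw_apply[OF bij_betw_inv_into])
  then show ?thesis
    using b by (auto simp: two_fold_def bij_betw_inv_into)
qed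

lemma two_fold_cong:
  assumes "two_fold V E f g" "\<And>x. x \<in> V \<Longrightarrow> f x = f' x" "\<And>x. x \<in> V \<Longrightarrow> g x = g' x"
  shows "two_fold V E f' g'"
  using assms bij_betw_cong[of V f f' V] bij_betw_cong[of V g g' V] by (simp add: two_fold_def)

section \<open>Undirected stable digraphs\<close>

text \<open>\<open>stable\<close> is the block condition in the form in which it is applied: an
  automorphism fixing \<open>(x, 0)\<close> maps \<open>{(x, 0), (x, 1)}\<close> to a set that meets
  it, hence to itself. \<open>arc_trans\<close> has separate maps for tails and heads because it
  comes from the double half-cover.\<close>

locale stable_symmetric =
  fixes V :: "'a set" and E :: "('a \<times> 'a) set"
  assumes wf: "E \<subseteq> V \<times> V"
    and sym: "sym E"
    and connected: "\<And>x y. x \<in> V \<Longrightarrow> y \<in> V \<Longrightarrow> (x, y) \<in> E\<^sup>*"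
    and stable: "\<And>f g x. two_fold V E f g \<Longrightarrow> x \<in> V \<Longrightarrow> f x = x \<Longrightarrow> g x = x"
    and arc_trans: "\<And>v w v' w'. (v, w) \<in> E \<Longrightarrow> (v', w') \<in> E \<Longrightarrow>
      \<exists>f g. two_fold V E f g \<and> f v = v' \<and> g w = w'"
    and branching: "\<exists>x y z. y \<noteq> z \<and> (x, y) \<in> E \<and> (x, z) \<in> E"
begin

section \<open>Twins, and agreement of the two components of an automorphism\<close>

lemma arc_in: "(x, y) \<in> E \<Longrightarrow> x \<in> V \<and> y \<in> V"
  using wf by auto

text \<open>Vertices with the same neighbours can be exchanged in one layer alone. The other
  component is the identity and fixes \<open>x\<close>, so stability forces the exchange to fix
  \<open>x\<close> as well.\<close>

lemma twin_free:
  assumes "x \<in> V" "x' \<in> V" "E `` {x} = E `` {x'}"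
  shows "x = x'"
proof -
  have "two_fold V E (transpose x x') id"
  proof -
    have "bij_betw (transpose x x') V V"
      by (rule bij_betw_byWitness[where f' = "transpose x x'"])
        (use assms(1,2) in \<open>auto simp: transpose_def\<close>)
    moreover have "(u, v) \<in> E \<longleftrightarrow> (transpose x x' u, v) \<in> E" for u v
      using assms(3) by (auto simp: transpose_def)
    ultimately show ?thesis
      by (auto simp: two_fold_def)
  qed
  from two_fold_swap[OF sym this] have "transpose x x' x = x"
    by (rule stable) (use assms in auto)
  then show ?thesis
    by simp
qed

text \<open>
  The stabilizer of \<open>x\<close> fixes \<open>r x\<close> for \<open>r = f\<inverse> g\<close>, since its conjugate by \<open>(f, g)\<close> fixes
  \<open>g x\<close>; and it is transitive on the neighbours of \<open>x\<close>, one of which is adjacent to \<open>r x\<close>.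
\<close>

lemma neighbours_subset:
  assumes tf: "two_fold V E f g" and y: "f y = g y" and xy: "(x, y) \<in> E"
  shows "E `` {x} \<subseteq> E `` {inv_into V f (g x)}"
proof
  fix z assume "z \<in> E `` {x}"
  then have xz: "(x, z) \<in> E" by simp
  have V: "x \<in> V" "y \<in> V" "z \<in> V"
    using xy xz arc_in by auto
  define f' g' where "f' = inv_into V f" and "g' = inv_into V g"
  note tf' = two_fold_inv[OF tf, folded f'_def g'_def]
  have bij: "bij_betw f V V" "bij_betw g V V"
    using tf by (auto simp: two_fold_def)
  have inv: "f' (f u) = u" "f (f' u) = u" "g' (g u) = u" "g (g' u) = u" if "u \<in> V" for u
    using that bij by (auto simp: f'_def g'_def bij_betw_inv_into_left bij_betw_inv_into_right)
  note mem = two_fold_in[OF tf] two_fold_in[OF tf']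
  let ?r = "f' (g x)"
  \<comment> \<open>The composite \<open>(f' \<circ> g, g' \<circ> f)\<close> preserves arcs, and
    agreement of \<open>f\<close> and \<open>g\<close> at \<open>y\<close> makes its second
    component fix \<open>y\<close>.\<close>
  have "(?r, g' (f y)) \<in> E"
    using two_fold_arc[OF two_fold_comp[OF two_fold_swap[OF sym tf] tf'], of x y] xy V by simp
  then have ry: "(?r, y) \<in> E"
    using y inv V by simp
  obtain p q where pq: "two_fold V E p q" "p x = x" "q y = z"
    using arc_trans[OF xy xz] by auto
  have "q x = x"
    using stable[OF pq(1)] pq(2) V by simp
  \<comment> \<open>The second component of this conjugate fixes \<open>g x\<close> because
    \<open>q\<close> fixes \<open>x\<close>; stability of the swapped pair carries this over to the
    first component.\<close>
  have "two_fold V E (f \<circ> (p \<circ> f')) (g \<circ> (q \<circ> g'))"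
    using tf tf' pq(1) two_fold_comp by blast
  from stable[OF two_fold_swap[OF sym this], of "g x"]
  have "f (p ?r) = g x"
    using mem V inv \<open>q x = x\<close> by simp
  then have "p ?r = ?r"
    using inv mem V two_fold_in[OF pq(1)] by metis
  then have "(?r, z) \<in> E"
    using two_fold_arc[OF pq(1), of ?r y] ry pq V mem by simp
  show "z \<in> E `` {inv_into V f (g x)}"
    using \<open>(?r, z) \<in> E\<close> by (simp add: f'_def)
qed

text \<open>An inclusion of infinite neighbourhoods need not come from an equality of vertices. The
  inclusion for the swapped pair at \<open>?r\<close> leads back, as \<open>g\<inverse> f\<close>
  sends \<open>?r\<close> to \<open>x\<close>; so \<open>x\<close> and \<open>?r\<close> are twins
  and coincide.\<close>

lemma agree_step:
  assumes tf: "two_fold V E f g" and y: "f y = g y" and xy: "(x, y) \<in> E"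
  shows "f x = g x"
proof -
  have bij: "bij_betw f V V" "bij_betw g V V"
    using tf by (auto simp: two_fold_def)
  have V: "x \<in> V" "y \<in> V"
    using xy arc_in by auto
  let ?r = "inv_into V f (g x)"
  have r: "?r \<in> V" "f ?r = g x"
    using V two_fold_in[OF tf] bij
    by (auto simp: bij_betw_inv_into_right bij_betw_apply[OF bij_betw_inv_into])
  have sub: "E `` {x} \<subseteq> E `` {?r}"
    by (rule neighbours_subset[OF assms])
  have "E `` {?r} \<subseteq> E `` {inv_into V g (f ?r)}"
    by (rule neighbours_subset[OF two_fold_swap[OF sym tf] y[symmetric]]) (use sub xy in auto)
  also have "inv_into V g (f ?r) = x"
    using r V bij by (simp add: bij_betw_inv_into_left)
  finally have "?r = x"
    using sub twin_free r V by blast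
  then show ?thesis
    using r by simp
qed

lemma agree:
  assumes tf: "two_fold V E f g" and x: "x \<in> V" "f x = g x" and y: "y \<in> V"
  shows "f y = g y"
  using connected[OF x(1) y]
proof induction
  case base
  then show ?case using x by simp
next
  case (step u w)
  then show ?case
    using agree_step[OF tf, of u w] symD[OF sym] by blast
qed

text \<open>By stability the two components agree at \<open>x\<close>, and then \<open>agree\<close>
  makes them equal on \<open>V\<close>; outside \<open>V\<close> they may differ, hence the appeal
  to \<open>two_fold_cong\<close>.\<close>

lemma stabilizer_diagonal:
  assumes "(x, y) \<in> E" "(x, z) \<in> E"
  obtains f where "two_fold V E f f" "f x = x" "f y = z"
proof -
  obtain f g where fg: "two_fold V E f g" "f x = x" "g y = z"
    using arc_trans[OF assms] by auto
  have V: "x \<in> V" "y \<in> V"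
    using assms arc_in by auto
  have "f u = g u" if "u \<in> V" for u
    using agree[OF fg(1) V(1) _ that] stable[OF fg(1) V(1)] fg by simp
  then have "two_fold V E f f"
    using two_fold_cong[OF fg(1)] by auto
  then show thesis
    using that[of f] fg V \<open>\<And>u. u \<in> V \<Longrightarrow> f u = g u\<close> by simp
qed

section \<open>Walks of even length, and transitivity of diagonal automorphisms on arcs\<close>

text \<open>One edge in front and one behind keep the length even; the induction regroups the edges
  into pairs shifted by one.\<close>

lemma even_walk_extend:
  assumes "(x, w) \<in> (E O E)\<^sup>*" "(y, x) \<in> E" "(w, w') \<in> E"
  shows "(y, w') \<in> (E O E)\<^sup>*"
  using assms
proof (induction arbitrary: w' rule: rtrancl_induct)
  case base
  then show ?case by auto
next
  case (step w w2)
  then obtain u where "(w, u) \<in> E" "(u, w2) \<in> E" by auto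
  then have "(y, u) \<in> (E O E)\<^sup>*" "(u, w') \<in> E O E"
    using step by auto
  then show ?case
    by (rule rtrancl_into_rtrancl)
qed

text \<open>
  If no closed walk had odd length, an automorphism \<open>p \<noteq> 1\<close> fixing \<open>x\<close> could be applied to
  one of the two connected components of the double half-cover alone.
\<close>

lemma even_walk: "\<exists>x. \<forall>w\<in>V. (x, w) \<in> (E O E)\<^sup>*"
proof -
  obtain x y z where xyz: "y \<noteq> z" "(x, y) \<in> E" "(x, z) \<in> E"
    using branching by auto
  have V: "x \<in> V" "y \<in> V" "z \<in> V"
    using xyz arc_in by auto
  obtain p where p: "two_fold V E p p" "p x = x" "p y = z"
    using stabilizer_diagonal[OF xyz(2,3)] .
  \<comment> \<open>\<open>A\<close> and \<open>B\<close> are the two layers of the connected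
    component of \<open>(x, 0)\<close> in the double half-cover.\<close>
  define A where "A = {w. (x, w) \<in> (E O E)\<^sup>*}"
  define B where "B = E `` A"
  have walk: "h a \<in> A" if "two_fold V E h h" "h x = x" "a \<in> A" for h a
  proof -
    have "(x, a) \<in> (E O E)\<^sup>*" using that by (simp add: A_def)
    then have "(h x, h a) \<in> (E O E)\<^sup>*"
    proof induction
      case base
      then show ?case by simp
    next
      case (step w w')
      then obtain u where "(w, u) \<in> E" "(u, w') \<in> E" by auto
      then have "(h w, h u) \<in> E" "(h u, h w') \<in> E"
        using two_fold_arc[OF that(1)] arc_in by auto
      then have "(h w, h w') \<in> E O E" by auto
      with step.IH show ?case by (rule rtrancl_into_rtrancl)
    qed
    then show ?thesis using that by (simp add: A_def)
  qed
  have bij: "bij_betw p V V"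
    using p by (simp add: two_fold_def)
  have AV: "A \<subseteq> V"
  proof
    fix w assume "w \<in> A"
    then have "(x, w) \<in> (E O E)\<^sup>*" by (simp add: A_def)
    then show "w \<in> V" by cases (use V arc_in in auto)
  qed
  have pA: "p w \<in> A \<longleftrightarrow> w \<in> A" if "w \<in> V" for w
  proof
    assume "p w \<in> A"
    moreover have "inv_into V p x = x"
      using p V bij by (metis bij_betw_inv_into_left)
    ultimately have "inv_into V p (p w) \<in> A"
      using walk[OF two_fold_inv[OF p(1)]] by simp
    then show "w \<in> A"
      using that bij by (simp add: bij_betw_inv_into_left)
  qed (use walk p in auto)
  have pB: "p w \<in> B \<longleftrightarrow> w \<in> B" if w: "w \<in> V" for w
  proof
    assume "w \<in> B"
    then obtain a where a: "a \<in> A" "(a, w) \<in> E"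
      by (auto simp: B_def)
    then have "p a \<in> A" "(p a, p w) \<in> E"
      using pA AV two_fold_arc[OF p(1)] w by auto
    then show "p w \<in> B"
      by (auto simp: B_def)
  next
    assume "p w \<in> B"
    then obtain b where b: "b \<in> A" "(b, p w) \<in> E"
      by (auto simp: B_def)
    then obtain a where a: "a \<in> V" "b = p a"
      using AV bij by (metis bij_betw_imp_surj_on imageE subsetD)
    then show "w \<in> B"
      using b pA two_fold_arc[OF p(1), of a w] w by (auto simp: B_def)
  qed
  have bij_on: "bij_betw (\<lambda>v. if v \<in> C then p v else v) V V"
    if C: "\<And>w. w \<in> V \<Longrightarrow> p w \<in> C \<longleftrightarrow> w \<in> C" for C
  proof (rule bij_betw_byWitness[where f' = "\<lambda>v. if v \<in> C then inv_into V p v else v"])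
    have i: "inv_into V p (p a) = a" "p (inv_into V p a) = a" "p a \<in> V" "inv_into V p a \<in> V"
      if "a \<in> V" for a
      using that bij bij_betw_apply[OF bij] bij_betw_apply[OF bij_betw_inv_into[OF bij]]
      by (simp_all add: bij_betw_inv_into_left bij_betw_inv_into_right)
    then have "inv_into V p a \<in> C \<longleftrightarrow> a \<in> C" if "a \<in> V" for a
      using C that by metis
    then show "\<forall>a\<in>V. (\<lambda>v. if v \<in> C then inv_into V p v else v) (if a \<in> C then p a else a) = a"
      "\<forall>a\<in>V. (\<lambda>v. if v \<in> C then p v else v) (if a \<in> C then inv_into V p a else a) = a"
      "(\<lambda>v. if v \<in> C then p v else v) ` V \<subseteq> V"
      "(\<lambda>v. if v \<in> C then inv_into V p v else v) ` V \<subseteq> V"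
      using i C by auto
  qed
  \<comment> \<open>This pair acts as \<open>p\<close> on the component of \<open>(x, 0)\<close> and
    trivially elsewhere. It is an automorphism whether or not closed walks of odd length
    exist.\<close>
  let ?f = "\<lambda>v. if v \<in> A then p v else v"
  let ?g = "\<lambda>v. if v \<in> B then p v else v"
  \<comment> \<open>By symmetry of \<open>E\<close>, no arc joins the component to its
    complement.\<close>
  have AB: "u \<in> A \<longleftrightarrow> v \<in> B" if uv: "(u, v) \<in> E" for u v
  proof
    assume "v \<in> B"
    then obtain a where "(x, a) \<in> (E O E)\<^sup>*" "(a, v) \<in> E"
      by (auto simp: B_def A_def)
    moreover have "(v, u) \<in> E"
      using uv sym by (auto dest: symD)
    ultimately show "u \<in> A"
      unfolding A_def by (auto intro: rtrancl_into_rtrancl)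
  qed (use uv in \<open>auto simp: B_def\<close>)
  have f_A: "?f u \<in> A \<longleftrightarrow> u \<in> A" and g_B: "?g u \<in> B \<longleftrightarrow> u \<in> B" if "u \<in> V" for u
    using that pA pB by auto
  have "two_fold V E ?f ?g"
    unfolding two_fold_def
  proof (intro conjI ballI bij_on)
    fix u v assume uv: "u \<in> V" "v \<in> V"
    show "(u, v) \<in> E \<longleftrightarrow> (?f u, ?g v) \<in> E"
    proof (cases "u \<in> A \<longleftrightarrow> v \<in> B")
      case True
      then show ?thesis
        using two_fold_arc[OF p(1) uv] by auto
    next
      case False
      then show ?thesis
        using AB[of u v] AB[of "?f u" "?g v"] f_A[OF uv(1)] g_B[OF uv(2)] by blast
    qed
  qed (use pA pB in auto)
  moreover have "x \<in> A"
    by (simp add: A_def)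
  moreover have "y \<in> B"
    using \<open>x \<in> A\<close> xyz by (auto simp: B_def)
  \<comment> \<open>Both maps fix \<open>x\<close>, so they agree at \<open>y\<close> too. As
    \<open>?g y = z \<noteq> y\<close>, also \<open>?f\<close> moves \<open>y\<close>, which can
    happen only on \<open>A\<close>: the neighbour \<open>y\<close> of \<open>x\<close> is reached
    by an even walk.\<close>
  ultimately have "?f y = ?g y"
    by (intro agree[of ?f ?g x y]) (use p V in auto)
  then have "y \<in> A"
    using \<open>y \<in> B\<close> p xyz by (auto split: if_splits)
  \<comment> \<open>The even walk from \<open>x\<close> to \<open>w\<close>, extended by
    \<open>y\<close> in front and \<open>w'\<close> behind, starts at \<open>y\<close>, and
    \<open>y\<close> itself lies in \<open>A\<close>. So \<open>A\<close> is closed under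
    adjacency.\<close>
  have step: "w' \<in> A" if "w \<in> A" "(w, w') \<in> E" for w w'
  proof -
    have "(y, w') \<in> (E O E)\<^sup>*"
      using even_walk_extend[of x w y w'] that xyz sym by (auto simp: A_def dest: symD)
    then show ?thesis
      using \<open>y \<in> A\<close> by (auto simp: A_def)
  qed
  have "(x, w) \<in> (E O E)\<^sup>*" if "w \<in> V" for w
  proof -
    have "w \<in> A"
      using connected[OF V(1) that] by induction (use \<open>x \<in> A\<close> step in auto)
    then show ?thesis by (simp add: A_def)
  qed
  then show ?thesis
    by blast
qed

text \<open>An even walk splits into pieces \<open>u, t, u'\<close>, and the stabilizer of
  \<open>t\<close> contains an automorphism taking \<open>u\<close> to \<open>u'\<close>. This
  yields transitivity on vertices; the stabilizer of \<open>v'\<close> then corrects the head of the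
  arc.\<close>

lemma diagonal_arc_transitive:
  assumes vw: "(v, w) \<in> E" and vw': "(v', w') \<in> E"
  obtains f where "two_fold V E f f" "f v = v'" "f w = w'"
proof -
  obtain x where x: "\<And>w. w \<in> V \<Longrightarrow> (x, w) \<in> (E O E)\<^sup>*"
    using even_walk by blast
  have move: "\<exists>f. two_fold V E f f \<and> f x = u" if "u \<in> V" for u
    using x[OF that]
  proof induction
    case base
    then show ?case
      by (intro exI[of _ id]) (auto simp: two_fold_def bij_betw_def)
  next
    case (step u u')
    then obtain t where t: "(u, t) \<in> E" "(t, u') \<in> E" by auto
    then obtain h where h: "two_fold V E h h" "h t = t" "h u = u'"
      using stabilizer_diagonal[of t u u'] sym by (metis symD)
    from step.IH obtain f where f: "two_fold V E f f" "f x = u" by auto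
    then show ?case
      using h two_fold_comp[OF f(1) h(1)] by (intro exI[of _ "h \<circ> f"]) (auto simp: o_def)
  qed
  have V: "v \<in> V" "v' \<in> V" "w \<in> V"
    using assms arc_in by auto
  have xV: "x \<in> V"
    using x[OF V(1)] by (cases rule: converse_rtranclE) (use V arc_in in auto)
  obtain a b where a: "two_fold V E a a" "a x = v" and b: "two_fold V E b b" "b x = v'"
    using move V by metis
  define c where "c = b \<circ> inv_into V a"
  have c: "two_fold V E c c"
    unfolding c_def using a b two_fold_inv two_fold_comp by blast
  have "bij_betw a V V"
    using a by (simp add: two_fold_def)
  then have cv: "c v = v'"
    using a b xV by (auto simp: c_def bij_betw_inv_into_left)
  have "(v', c w) \<in> E"
    using two_fold_arc[OF c, of v w] V vw cv by simp
  then obtain h where "two_fold V E h h" "h v' = v'" "h (c w) = w'"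
    using stabilizer_diagonal[of v' "c w" w'] vw' by auto
  then show thesis
    using that[of "h \<circ> c"] two_fold_comp[OF c] cv by auto
qed

end

section \<open>Quotients by shift powers\<close>

lemma aut_mult:
  assumes "f \<in> carrier (digraph_aut \<Gamma>)" "g \<in> carrier (digraph_aut \<Gamma>)" "u \<in> pverts \<Gamma>"
  shows "(f \<otimes>\<^bsub>digraph_aut \<Gamma>\<^esub> g) u = f (g u)"
  using assms by (simp add: digraph_aut_def BijGroup_def compose_def)

lemma aut_one: "u \<in> pverts \<Gamma> \<Longrightarrow> \<one>\<^bsub>digraph_aut \<Gamma>\<^esub> u = u"
  by (simp add: digraph_aut_def BijGroup_def)

lemma aut_bij: "f \<in> carrier (digraph_aut \<Gamma>) \<Longrightarrow> bij_betw f (pverts \<Gamma>) (pverts \<Gamma>)"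
  by (simp add: digraph_aut_def Bij_def)

lemma aut_arc:
  "f \<in> carrier (digraph_aut \<Gamma>) \<Longrightarrow> u \<in> pverts \<Gamma> \<Longrightarrow> v \<in> pverts \<Gamma> \<Longrightarrow>
    (f u, f v) \<in> parcs \<Gamma> \<longleftrightarrow> (u, v) \<in> parcs \<Gamma>"
  by (simp add: digraph_aut_def)

lemma restrict_aut:
  assumes "bij_betw f (pverts \<Gamma>) (pverts \<Gamma>)"
    and "\<And>u v. u \<in> pverts \<Gamma> \<Longrightarrow> v \<in> pverts \<Gamma> \<Longrightarrow> (u, v) \<in> parcs \<Gamma> \<longleftrightarrow> (f u, f v) \<in> parcs \<Gamma>"
  shows "restrict f (pverts \<Gamma>) \<in> carrier (digraph_aut \<Gamma>)"
  using assms bij_betw_restrict_eq[of f "pverts \<Gamma>" "pverts \<Gamma>"]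
  by (simp add: digraph_aut_def Bij_def)

definition rotate_right :: "'a list \<Rightarrow> 'a list" where
  "rotate_right x = last x # butlast x"

text \<open>When \<open>length x\<close> divides \<open>n\<close>, \<open>rotate n x\<close> is
  \<open>x\<close>, so \<open>n\<close> steps of \<open>rotate_right\<close> also return to
  \<open>x\<close>.\<close>

lemma funpow_rotate_right: "x \<noteq> [] \<Longrightarrow> (rotate_right ^^ n) (rotate n x) = x"
proof (induction n)
  case (Suc n)
  have r: "rotate_right (rotate1 y) = y" if "y \<noteq> []" for y :: "'a list"
    using that by (cases y) (auto simp: rotate_right_def)
  have "(rotate_right ^^ Suc n) (rotate (Suc n) x) = (rotate_right ^^ n) (rotate n x)"
    using r[of "rotate n x"] Suc.prems
    by (simp only: funpow_Suc_right o_apply rotate_Suc rotate_is_Nil_conv not_False_eq_True)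
  then show ?case
    using Suc by simp
qed simp

text \<open>With \<open>a = i - j - 1\<close> this says that the number of changes of coordinate
  \<open>j\<close> goes up between times \<open>i\<close> and \<open>i + 1\<close> exactly if
  \<open>i\<close> and \<open>j\<close> are congruent modulo \<open>k\<close>.\<close>

lemma succ_div:
  fixes a k :: int
  assumes "k > 0"
  shows "(a + 1) div k = (if k dvd a + 1 then a div k + 1 else a div k)"
proof (cases "k dvd a + 1")
  case True
  then obtain c where "a + 1 = k * c" by auto
  moreover from this have "a = (k - 1) + k * (c - 1)" by (simp add: algebra_simps)
  then have "a div k = (c - 1)"
    using assms by simp
  ultimately show ?thesis
    using assms by simp
next
  case False
  have "a mod k + 1 \<noteq> k"
  proof
    assume "a mod k + 1 = k"
    moreover have "a + 1 = k * (a div k) + (a mod k + 1)" by simp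
    ultimately have "a + 1 = k * (a div k) + k" by simp
    with False show False by simp
  qed
  then have "a mod k + 1 < k"
    using assms pos_mod_bound[of k a] by linarith
  moreover have "a + 1 = k * (a div k) + (a mod k + 1)" by simp
  moreover have "0 \<le> a mod k + 1"
    using assms pos_mod_sign[of k a] by linarith
  ultimately have "(a + 1) div k = a div k"
    by (intro int_div_pos_eq)
  then show ?thesis
    using False by simp
qed

text \<open>Since \<open>k dvd q\<close>, the power \<open>s^q\<close> rotates lists by full turns:
  it only advances the time, and it keeps the coordinate that is due to be changed.\<close>

locale Z_quotient =
  fixes \<Delta> :: "'a pair_pre_digraph" and k q :: nat
  assumes arcs_wf: "parcs \<Delta> \<subseteq> pverts \<Delta> \<times> pverts \<Delta>"
    and k: "k > 0" and kq: "k dvd q"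
begin

abbreviation "V \<equiv> pverts \<Delta>"
abbreviation "E \<equiv> parcs \<Delta>"
abbreviation "\<Gamma> \<equiv> Z_digraph \<Delta> k"
abbreviation "A \<equiv> digraph_aut \<Gamma>"
abbreviation "N \<equiv> shift_power_group \<Delta> k q"
abbreviation "Q \<equiv> quotient_digraph \<Gamma> N"

definition X where "X = {x. length x = k \<and> set x \<subseteq> V}"

lemma pverts_Z: "pverts \<Gamma> = UNIV \<times> X"
  by (simp add: Z_digraph_def Let_def X_def)

lemma arc_Z:
  "((i, v), (i', w)) \<in> parcs \<Gamma> \<longleftrightarrow> v \<in> X \<and> w \<in> X \<and> i' = i + 1 \<and>
    (\<forall>j<k. if [int j = i] (mod int k) then (v ! j, w ! j) \<in> E else v ! j = w ! j)"
  by (auto simp: Z_digraph_def Let_def X_def)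

lemma arc_Z_pair:
  "(u, u') \<in> parcs \<Gamma> \<longleftrightarrow> snd u \<in> X \<and> snd u' \<in> X \<and> fst u' = fst u + 1 \<and>
    (\<forall>j<k. if [int j = fst u] (mod int k) then (snd u ! j, snd u' ! j) \<in> E
      else snd u ! j = snd u' ! j)"
  by (cases u; cases u') (simp add: arc_Z)

lemma arc_Z_in: "(u, u') \<in> parcs \<Gamma> \<Longrightarrow> u \<in> pverts \<Gamma> \<and> u' \<in> pverts \<Gamma>"
  by (cases u; cases u') (simp add: arc_Z pverts_Z)

lemma X_nth: "x \<in> X \<Longrightarrow> j < k \<Longrightarrow> x ! j \<in> V"
  by (auto simp: X_def)

lemma X_map: "map f [0..<k] \<in> X \<longleftrightarrow> (\<forall>j<k. f j \<in> V)"
  by (auto simp: X_def)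

lemma X_eqI: "x \<in> X \<Longrightarrow> y \<in> X \<Longrightarrow> (\<And>j. j < k \<Longrightarrow> x ! j = y ! j) \<Longrightarrow> x = y"
  by (auto simp: X_def intro: nth_equalityI)

subsection \<open>Orbits of the shift power\<close>

text \<open>The orbit under \<open>N\<close> in explicit form, by \<open>orbit_of_eq\<close>. It
  makes sense for lists outside \<open>X\<close> too, which frees \<open>orb_shift\<close> and
  \<open>orb_mem\<close> from side conditions.\<close>

definition orb :: "int \<times> 'a list \<Rightarrow> (int \<times> 'a list) set" where
  "orb u = {(fst u + int q * m, snd u) | m. True}"

lemma orb_range: "orb u = range (\<lambda>m. (fst u + int q * m, snd u))"
  by (auto simp: orb_def)

lemma rot_in: "x \<in> X \<Longrightarrow> rotate_right x \<in> X"
  using k by (cases x rule: rev_cases) (auto simp: X_def rotate_right_def)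

lemma shift_apply: "x \<in> X \<Longrightarrow> Z_shift \<Delta> k (i, x) = (i + 1, rotate_right x)"
  by (simp add: Z_shift_def pverts_Z rotate_right_def)

lemma shift_in: "Z_shift \<Delta> k \<in> carrier A"
  using k by (rule Z_shift_in_aut)

interpretation A: group A
  by (rule group_digraph_aut)

lemma shift_pow:
  assumes "x \<in> X"
  shows "(Z_shift \<Delta> k [^]\<^bsub>A\<^esub> n) (i, x) = (i + int n, (rotate_right ^^ n) x)"
  using assms
proof (induction n arbitrary: i x)
  case 0
  then show ?case by (simp add: aut_one pverts_Z)
next
  case (Suc n)
  then show ?case
    by (simp add: aut_mult shift_in pverts_Z shift_apply rot_in funpow_swap1)
qed

lemma shift_pow_q:
  assumes "u \<in> pverts \<Gamma>"
  shows "(Z_shift \<Delta> k [^]\<^bsub>A\<^esub> q) u = (fst u + int q, snd u)"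
proof -
  obtain i x where u: "u = (i, x)" "x \<in> X"
    using assms by (auto simp: pverts_Z)
  have "x \<noteq> []" "rotate q x = x"
    using u k kq by (auto simp: X_def intro: rotate_id)
  then show ?thesis
    using funpow_rotate_right[of x q] u by (simp add: shift_pow)
qed

lemma orbit_of_eq:
  assumes u: "u \<in> pverts \<Gamma>"
  shows "orbit_of N u = orb u"
proof -
  define a where "a = Z_shift \<Delta> k [^]\<^bsub>A\<^esub> q"
  have a: "a \<in> carrier A"
    by (simp add: a_def shift_in)
  have a_app: "a u = (fst u + int q, snd u)" if "u \<in> pverts \<Gamma>" for u
    using shift_pow_q[OF that] by (simp add: a_def)
  have N: "N = generate A {a}"
    by (simp add: shift_power_group_def a_def Let_def)
  have tr: "(i, snd u) \<in> pverts \<Gamma>" if "u \<in> pverts \<Gamma>" for i u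
    using that by (auto simp: pverts_Z)
  have inv_app: "(inv\<^bsub>A\<^esub> a) u = (fst u - int q, snd u)" if "u \<in> pverts \<Gamma>" for u
  proof -
    have "(inv\<^bsub>A\<^esub> a) (a (fst u - int q, snd u)) = (fst u - int q, snd u)"
      using aut_mult[OF A.inv_closed[OF a] a tr[OF that]] a tr[OF that] by (simp add: aut_one)
    then show ?thesis
      by (simp add: a_app[OF tr[OF that]])
  qed
  have a_gen: "a \<in> generate A {a}" "inv\<^bsub>A\<^esub> a \<in> generate A {a}"
    by (auto intro: generate.incl generate.inv)
  have gen_carrier: "generate A {a} \<subseteq> carrier A"
    using a by (intro A.generate_incl) auto
  have sub: "\<exists>m. \<forall>u\<in>pverts \<Gamma>. g u = (fst u + int q * m, snd u)" if "g \<in> generate A {a}" for g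
    using that
  proof induction
    case one
    then show ?case by (intro exI[of _ 0]) (simp add: aut_one)
  next
    case (incl h)
    then show ?case by (intro exI[of _ 1]) (simp add: a_app)
  next
    case (inv h)
    then show ?case by (intro exI[of _ "-1"]) (simp add: inv_app)
  next
    case (eng g h)
    then obtain m m' where
      "\<forall>u\<in>pverts \<Gamma>. g u = (fst u + int q * m, snd u)"
      "\<forall>u\<in>pverts \<Gamma>. h u = (fst u + int q * m', snd u)" by auto
    then show ?case
      using eng gen_carrier tr
      by (intro exI[of _ "m' + m"]) (auto simp: aut_mult subset_iff algebra_simps)
  qed
  have sup: "\<exists>g\<in>generate A {a}. g u = (fst u + int q * m, snd u)" for m
  proof (induction m rule: int_induct[where k = 0])
    case base
    then show ?case
      using generate.one u by (intro bexI[of _ "\<one>\<^bsub>A\<^esub>"]) (auto simp: aut_one)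
  next
    case (step1 m)
    then obtain g where g: "g \<in> generate A {a}" "g u = (fst u + int q * m, snd u)" by auto
    have "(a \<otimes>\<^bsub>A\<^esub> g) u = (fst u + int q * (m + 1), snd u)"
      using a g gen_carrier u tr[OF u] by (simp add: aut_mult a_app subset_iff algebra_simps)
    then show ?case
      using generate.eng[OF a_gen(1) g(1)] by blast
  next
    case (step2 m)
    then obtain g where g: "g \<in> generate A {a}" "g u = (fst u + int q * m, snd u)" by auto
    have "(inv\<^bsub>A\<^esub> a \<otimes>\<^bsub>A\<^esub> g) u = (fst u + int q * (m - 1), snd u)"
      using a g gen_carrier u tr[OF u] by (simp add: aut_mult inv_app subset_iff algebra_simps)
    then show ?case
      using generate.eng[OF a_gen(2) g(1)] by blast
  qed
  show ?thesis
  proof (intro equalityI subsetI)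
    fix w assume "w \<in> orbit_of N u"
    then obtain g where "g \<in> generate A {a}" "w = g u"
      by (auto simp: orbit_of_def N)
    with sub[of g] u show "w \<in> orb u"
      by (auto simp: orb_def)
  next
    fix w assume "w \<in> orb u"
    then obtain m where "w = (fst u + int q * m, snd u)"
      by (auto simp: orb_def)
    moreover obtain g where "g \<in> generate A {a}" "g u = (fst u + int q * m, snd u)"
      using sup[of m] by blast
    ultimately show "w \<in> orbit_of N u"
      unfolding orbit_of_def N by (metis (mono_tags, lifting) mem_Collect_eq)
  qed
qed

lemma pverts_Q: "pverts Q = orb ` pverts \<Gamma>"
  using orbit_of_eq by (simp add: quotient_digraph_def)

lemma snd_orb: "w \<in> orb u \<Longrightarrow> snd w = snd u"
  by (auto simp: orb_def)

lemma orb_self: "u \<in> orb u"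
  by (auto simp: orb_def intro: exI[of _ 0])

lemma snd_orb_eq: "orb u = orb w \<Longrightarrow> snd u = snd w"
  using orb_self[of u] snd_orb by metis

lemma orb_shift: "orb (i + int q * m, x) = orb (i, x)"
proof -
  have "\<exists>m''. i + int q * m + int q * m' = i + int q * m''" for m'
    by (intro exI[of _ "m + m'"]) (simp add: algebra_simps)
  moreover have "\<exists>m''. i + int q * m' = i + int q * m + int q * m''" for m'
    by (intro exI[of _ "m' - m"]) (simp add: algebra_simps)
  ultimately show ?thesis
    by (auto simp: orb_def)
qed

lemma orb_mem:
  assumes "u \<in> orb w"
  shows "orb u = orb w"
proof -
  obtain m where "u = (fst w + int q * m, snd w)"
    using assms by (auto simp: orb_def)
  then show ?thesis
    using orb_shift[of "fst w" m "snd w"] by simp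
qed

lemma arc_Z_shift:
  "((i + int q * m, v), (i' + int q * m, w)) \<in> parcs \<Gamma> \<longleftrightarrow> ((i, v), (i', w)) \<in> parcs \<Gamma>"
proof -
  have "[i + int q * m = i] (mod int k)"
    using kq by (simp add: cong_iff_dvd_diff)
  then have "[int j = i + int q * m] (mod int k) \<longleftrightarrow> [int j = i] (mod int k)" for j
    by (meson cong_sym cong_trans)
  then show ?thesis
    by (auto simp: arc_Z)
qed

text \<open>Translations by multiples of \<open>q\<close> preserve arcs, so an arc between two
  orbits can be moved to start at any chosen representative of the first.\<close>

lemma arc_Q:
  assumes "u \<in> pverts \<Gamma>"
  shows "(orb u, B) \<in> parcs Q \<longleftrightarrow> (\<exists>b. (u, b) \<in> parcs \<Gamma> \<and> B = orb b)"
proof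
  assume "(orb u, B) \<in> parcs Q"
  then obtain a b where ab: "a \<in> orb u" "b \<in> B" "(a, b) \<in> parcs \<Gamma>" and "B \<in> pverts Q"
    by (auto simp: quotient_digraph_def)
  then obtain c where "B = orb c"
    by (auto simp: pverts_Q)
  then have B: "B = orb b"
    using ab(2) orb_mem[of b c] by simp
  obtain m where "a = (fst u + int q * m, snd u)"
    using ab(1) by (auto simp: orb_def)
  then have "((fst u, snd u), (fst b - int q * m, snd b)) \<in> parcs \<Gamma>"
    using ab(3) arc_Z_shift[of "fst u" m "snd u" "fst b - int q * m" "snd b"] by simp
  moreover have "B = orb (fst b - int q * m, snd b)"
    using orb_shift[of "fst b - int q * m" m "snd b"] B by simp
  ultimately show "\<exists>b. (u, b) \<in> parcs \<Gamma> \<and> B = orb b"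
    by (metis prod.collapse)
next
  assume "\<exists>b. (u, b) \<in> parcs \<Gamma> \<and> B = orb b"
  then obtain b where b: "(u, b) \<in> parcs \<Gamma>" "B = orb b"
    by blast
  then have "orb u \<in> pverts Q" "B \<in> pverts Q"
    using arc_Z_in[OF b(1)] by (simp_all add: pverts_Q)
  then show "(orb u, B) \<in> parcs Q"
    using b orb_self[of u] orb_self[of b] by (auto simp: quotient_digraph_def)
qed

section \<open>Lifting walks from the quotient; finiteness of the quotient\<close>

lemma relpow_Q:
  assumes "u \<in> pverts \<Gamma>"
  shows "(orb u, B) \<in> parcs Q ^^ m \<longleftrightarrow> (\<exists>b\<in>pverts \<Gamma>. (u, b) \<in> parcs \<Gamma> ^^ m \<and> B = orb b)"
proof (induction m arbitrary: B)
  case 0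
  then show ?case using assms by auto
next
  case (Suc m)
  show ?case
  proof
    assume "(orb u, B) \<in> parcs Q ^^ Suc m"
    then obtain C where "(orb u, C) \<in> parcs Q ^^ m" "(C, B) \<in> parcs Q" by auto
    then obtain c where c: "c \<in> pverts \<Gamma>" "(u, c) \<in> parcs \<Gamma> ^^ m" "(orb c, B) \<in> parcs Q"
      using Suc by auto
    then obtain b where "(c, b) \<in> parcs \<Gamma>" "B = orb b"
      using arc_Q[OF c(1)] by blast
    then show "\<exists>b\<in>pverts \<Gamma>. (u, b) \<in> parcs \<Gamma> ^^ Suc m \<and> B = orb b"
      using c(2) arc_Z_in by (intro bexI[of _ b]) auto
  next
    assume "\<exists>b\<in>pverts \<Gamma>. (u, b) \<in> parcs \<Gamma> ^^ Suc m \<and> B = orb b"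
    then obtain b c where b: "(u, c) \<in> parcs \<Gamma> ^^ m" "(c, b) \<in> parcs \<Gamma>" "B = orb b"
      by (auto elim: relpow_Suc_E)
    then have c: "c \<in> pverts \<Gamma>"
      using arc_Z_in by blast
    then have "(orb u, orb c) \<in> parcs Q ^^ m"
      using Suc b(1) by blast
    moreover have "(orb c, B) \<in> parcs Q"
      using arc_Q[OF c] b(2,3) by blast
    ultimately show "(orb u, B) \<in> parcs Q ^^ Suc m"
      by (rule relpow_Suc_I)
  qed
qed

lemma lift_k_arc:
  assumes "p \<in> k_arcs n Q"
  obtains r where "r \<in> k_arcs n \<Gamma>" "p = map orb r"
proof -
  \<comment> \<open>The start of the lift is prescribed, so that in the induction the lift of the
    remaining walk can begin at an out-neighbour of \<open>u\<close>.\<close>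
  have lift: "\<exists>r\<in>k_arcs n \<Gamma>. r ! 0 = u \<and> p = map orb r"
    if "p \<in> k_arcs n Q" "u \<in> pverts \<Gamma>" "orb u = p ! 0" for u
    using that
  proof (induction n arbitrary: p u)
    case 0
    then show ?case
      by (intro bexI[of _ "[u]"]) (auto simp: k_arcs_def length_Suc_conv)
  next
    case (Suc n)
    then obtain p' where p: "p = orb u # p'"
      by (cases p) (auto simp: k_arcs_def)
    then have p': "p' \<in> k_arcs n Q" and arc: "(orb u, p' ! 0) \<in> parcs Q"
      using Suc.prems(1) by (auto simp: k_arcs_def All_less_Suc2 nth_Cons')
    then obtain b where b: "(u, b) \<in> parcs \<Gamma>" "p' ! 0 = orb b"
      using arc_Q[OF Suc.prems(2)] by blast
    then obtain r where r: "r \<in> k_arcs n \<Gamma>" "r ! 0 = b" "p' = map orb r"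
      using Suc.IH[OF p', of b] arc_Z_in by auto
    have "u # r \<in> k_arcs (Suc n) \<Gamma>"
      using r b Suc.prems(2) by (simp add: k_arcs_def All_less_Suc2)
    then show ?case
      using r p by (intro bexI[of _ "u # r"]) auto
  qed
  have "p ! 0 \<in> pverts Q"
    using assms by (cases p) (auto simp: k_arcs_def)
  then obtain u where "u \<in> pverts \<Gamma>" "p ! 0 = orb u"
    by (auto simp: pverts_Q)
  with lift[OF assms, of u] obtain r where "r \<in> k_arcs n \<Gamma>" "p = map orb r"
    by metis
  then show thesis
    by (rule that)
qed

lemma wf_Q: "pair_wf_digraph Q"
  by unfold_locales (auto simp: quotient_digraph_def)

lemma finite_Q:
  assumes "finite V" "q > 0"
  shows "pair_fin_digraph Q"
proof -
  have "finite X"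
    unfolding X_def using finite_lists_length_eq[OF assms(1), of k] by (simp add: conj_commute)
  have "pverts Q \<subseteq> orb ` ({0..<int q} \<times> X)"
  proof
    fix B assume "B \<in> pverts Q"
    then obtain i x where "B = orb (i, x)" "x \<in> X"
      by (auto simp: pverts_Q pverts_Z)
    then have "B = orb (i mod int q, x)" "(i mod int q, x) \<in> {0..<int q} \<times> X"
      using orb_shift[of "i mod int q" "i div int q" x] assms by auto
    then show "B \<in> orb ` ({0..<int q} \<times> X)" by blast
  qed
  then have fin: "finite (pverts Q)"
    using \<open>finite X\<close> by (meson finite_SigmaI finite_atLeastLessThan_int finite_imageI finite_subset)
  moreover have "parcs Q \<subseteq> pverts Q \<times> pverts Q"
    by (auto simp: quotient_digraph_def)
  then have "finite (parcs Q)"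
    using fin by (meson finite_SigmaI finite_subset)
  ultimately show ?thesis
    using wf_Q by (simp add: pair_fin_digraph_def pair_fin_digraph_axioms_def)
qed

subsection \<open>Automorphisms of the quotient\<close>

text \<open>The last clause makes \<open>F\<close> permute the orbits of \<open>N\<close>, so that
  it passes to the quotient.\<close>

definition equivariant_aut :: "(int \<times> 'a list \<Rightarrow> int \<times> 'a list) \<Rightarrow> bool" where
  "equivariant_aut F \<longleftrightarrow> bij_betw F (pverts \<Gamma>) (pverts \<Gamma>) \<and>
     (\<forall>u\<in>pverts \<Gamma>. \<forall>v\<in>pverts \<Gamma>. (F u, F v) \<in> parcs \<Gamma> \<longleftrightarrow> (u, v) \<in> parcs \<Gamma>) \<and>
     (\<forall>u\<in>pverts \<Gamma>. F ` orb u = orb (F u))"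

lemma equivariant_aut_in: "equivariant_aut F \<Longrightarrow> u \<in> pverts \<Gamma> \<Longrightarrow> F u \<in> pverts \<Gamma>"
  by (auto simp: equivariant_aut_def bij_betw_apply)

lemma equivariant_aut_comp:
  assumes F: "equivariant_aut F" and G: "equivariant_aut G"
  shows "equivariant_aut (G \<circ> F)"
  unfolding equivariant_aut_def
proof (intro conjI ballI)
  show "bij_betw (G \<circ> F) (pverts \<Gamma>) (pverts \<Gamma>)"
    using F G by (auto simp: equivariant_aut_def intro: bij_betw_trans)
next
  fix u v assume "u \<in> pverts \<Gamma>" "v \<in> pverts \<Gamma>"
  then show "((G \<circ> F) u, (G \<circ> F) v) \<in> parcs \<Gamma> \<longleftrightarrow> (u, v) \<in> parcs \<Gamma>"
    using F G equivariant_aut_in[OF F] unfolding equivariant_aut_def o_apply by metis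
next
  fix u assume "u \<in> pverts \<Gamma>"
  then show "(G \<circ> F) ` orb u = orb ((G \<circ> F) u)"
    using F G equivariant_aut_in[OF F] unfolding equivariant_aut_def image_comp[symmetric] o_apply
    by metis
qed

lemma equivariant_aut_orb: "equivariant_aut F \<Longrightarrow> u \<in> pverts \<Gamma> \<Longrightarrow> F ` orb u = orb (F u)"
  by (simp add: equivariant_aut_def)

lemma orb_subset: "u \<in> pverts \<Gamma> \<Longrightarrow> orb u \<subseteq> pverts \<Gamma>"
  by (auto simp: orb_def pverts_Z)

lemma equivariant_aut_inv:
  assumes F: "equivariant_aut F"
  shows "equivariant_aut (inv_into (pverts \<Gamma>) F)"
proof -
  let ?G = "inv_into (pverts \<Gamma>) F"
  have bij: "bij_betw F (pverts \<Gamma>) (pverts \<Gamma>)"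
    using F by (simp add: equivariant_aut_def)
  have G: "?G u \<in> pverts \<Gamma>" "F (?G u) = u" if "u \<in> pverts \<Gamma>" for u
    using that bij bij_betw_apply[OF bij_betw_inv_into[OF bij]]
    by (auto simp: bij_betw_inv_into_right)
  have "?G ` orb u = orb (?G u)" if u: "u \<in> pverts \<Gamma>" for u
  proof -
    have "?G ` F ` orb (?G u) = orb (?G u)"
      by (rule inv_into_image_cancel[OF bij_betw_imp_inj_on[OF bij] orb_subset[OF G(1)[OF u]]])
    then show ?thesis
      using F G[OF u] by (simp add: equivariant_aut_def)
  qed
  moreover have "(?G u, ?G v) \<in> parcs \<Gamma> \<longleftrightarrow> (u, v) \<in> parcs \<Gamma>"
    if "u \<in> pverts \<Gamma>" "v \<in> pverts \<Gamma>" for u v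
    using F G that unfolding equivariant_aut_def by metis
  ultimately show ?thesis
    using bij by (simp add: equivariant_aut_def bij_betw_inv_into)
qed

text \<open>The arc lifts to one from \<open>u\<close> to some other representative \<open>b\<close>
  of \<open>orb v\<close>, and \<open>F\<close> keeps \<open>b\<close> and \<open>v\<close> in a
  common orbit. The converse implication will come from the inverse of \<open>F\<close>.\<close>

lemma equivariant_aut_arc_Q:
  assumes F: "equivariant_aut F" and uv: "u \<in> pverts \<Gamma>" "v \<in> pverts \<Gamma>"
    and arc: "(orb u, orb v) \<in> parcs Q"
  shows "(orb (F u), orb (F v)) \<in> parcs Q"
proof -
  obtain b where b: "(u, b) \<in> parcs \<Gamma>" "orb v = orb b"
    using arc arc_Q[OF uv(1)] by blast
  have bV: "b \<in> pverts \<Gamma>"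
    using arc_Z_in[OF b(1)] by simp
  have "(F u, F b) \<in> parcs \<Gamma>"
    using F uv(1) bV b(1) by (simp add: equivariant_aut_def)
  moreover have "orb (F v) = orb (F b)"
    using equivariant_aut_orb[OF F] uv(2) bV b(2) by metis
  ultimately show ?thesis
    using arc_Q[OF equivariant_aut_in[OF F uv(1)]] by blast
qed

lemma equivariant_aut_Q:
  assumes F: "equivariant_aut F"
  shows "\<exists>g\<in>carrier (digraph_aut Q). \<forall>u\<in>pverts \<Gamma>. g (orb u) = orb (F u)"
proof -
  define g where "g = restrict ((`) F) (pverts Q)"
  let ?G = "inv_into (pverts \<Gamma>) F"
  note G = equivariant_aut_inv[OF F]
  have bij: "bij_betw F (pverts \<Gamma>) (pverts \<Gamma>)"
    using F by (simp add: equivariant_aut_def)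
  have FG: "F (?G u) = u" "?G (F u) = u" if "u \<in> pverts \<Gamma>" for u
    using that bij by (auto simp: bij_betw_inv_into_right bij_betw_inv_into_left)
  note img = equivariant_aut_orb[OF F] equivariant_aut_orb[OF G]
  have "?G ` F ` B = B \<and> F ` ?G ` B = B \<and> F ` B \<in> pverts Q \<and> ?G ` B \<in> pverts Q"
    if B: "B \<in> pverts Q" for B
  proof -
    obtain u where u: "B = orb u" "u \<in> pverts \<Gamma>"
      using B unfolding pverts_Q by blast
    note mem = equivariant_aut_in[OF F u(2)] equivariant_aut_in[OF G u(2)]
    show ?thesis
      using u(2) mem by (simp add: u(1) img FG pverts_Q)
  qed
  then have "bij_betw ((`) F) (pverts Q) (pverts Q)"
    by (intro bij_betw_byWitness[where f' = "(`) ?G"]) blast+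
  moreover have "(B, C) \<in> parcs Q \<longleftrightarrow> (F ` B, F ` C) \<in> parcs Q"
    if BC: "B \<in> pverts Q" "C \<in> pverts Q" for B C
  proof -
    obtain u v where u: "B = orb u" "C = orb v" "u \<in> pverts \<Gamma>" "v \<in> pverts \<Gamma>"
      using BC unfolding pverts_Q by blast
    then have "(orb u, orb v) \<in> parcs Q \<longleftrightarrow> (orb (F u), orb (F v)) \<in> parcs Q"
      using equivariant_aut_arc_Q[OF F] equivariant_aut_arc_Q[OF G, of "F u" "F v"]
        equivariant_aut_in[OF F] FG by metis
    then show ?thesis
      using u img by simp
  qed
  ultimately have "g \<in> carrier (digraph_aut Q)"
    unfolding g_def by (rule restrict_aut)
  moreover have "g (orb u) = orb (F u)" if "u \<in> pverts \<Gamma>" for u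
    using that img by (simp add: g_def pverts_Q)
  ultimately show ?thesis
    by blast
qed

lemma equivariant_aut_k_arc:
  assumes F: "equivariant_aut F" and r: "r \<in> k_arcs n \<Gamma>"
  shows "map F r \<in> k_arcs n \<Gamma>"
proof -
  have "r ! i \<in> pverts \<Gamma>" if "i \<le> n" for i
    using r that by (auto simp: k_arcs_def)
  then show ?thesis
    using F r equivariant_aut_in[OF F] by (auto simp: k_arcs_def equivariant_aut_def)
qed

text \<open>Powers of the shift do this, whatever they do to the lists. They serve to bring the
  start of a \<open>k\<close>-arc to time 0.\<close>

lemma equivariant_translation:
  "\<exists>F. equivariant_aut F \<and> (\<forall>u\<in>pverts \<Gamma>. fst (F u) = fst u + c)"
proof (induction c rule: int_induct[where k = 0])
  case base
  then show ?case
    by (intro exI[of _ id]) (auto simp: equivariant_aut_def bij_betw_def)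
next
  have S: "equivariant_aut (Z_shift \<Delta> k)"
    unfolding equivariant_aut_def
  proof (intro conjI ballI)
    fix u assume u: "u \<in> pverts \<Gamma>"
    have "Z_shift \<Delta> k (i, snd u) = (i + 1, rotate_right (snd u))" for i
      using u shift_apply by (auto simp: pverts_Z)
    then show "Z_shift \<Delta> k ` orb u = orb (Z_shift \<Delta> k u)"
      by (cases u) (auto simp: orb_def image_iff algebra_simps)
  qed (use aut_bij[OF shift_in] aut_arc[OF shift_in] in auto)
  have S_fst: "fst (Z_shift \<Delta> k u) = fst u + 1" if "u \<in> pverts \<Gamma>" for u
    using that shift_apply by (auto simp: pverts_Z)
  {
    case (step1 c)
    then obtain F where F: "equivariant_aut F" "\<forall>u\<in>pverts \<Gamma>. fst (F u) = fst u + c" by auto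
    then have "fst ((Z_shift \<Delta> k \<circ> F) u) = fst u + (c + 1)" if "u \<in> pverts \<Gamma>" for u
      using that S_fst[OF equivariant_aut_in[OF F(1)]] by simp
    then show ?case
      using equivariant_aut_comp[OF F(1) S] by blast
  next
    case (step2 c)
    then obtain F where F: "equivariant_aut F" "\<forall>u\<in>pverts \<Gamma>. fst (F u) = fst u + c" by auto
    let ?G = "inv_into (pverts \<Gamma>) (Z_shift \<Delta> k)"
    note G = equivariant_aut_inv[OF S]
    have G_fst: "fst (?G u) = fst u - 1" if "u \<in> pverts \<Gamma>" for u
      using S_fst[of "?G u"] equivariant_aut_in[OF G that] that
        bij_betw_inv_into_right[OF aut_bij[OF shift_in]] by simp
    have "fst ((?G \<circ> F) u) = fst u + (c - 1)" if "u \<in> pverts \<Gamma>" for u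
      using that G_fst[OF equivariant_aut_in[OF F(1)]] F(2) by simp
    then show ?case
      using equivariant_aut_comp[OF F(1) G] by blast
  }
qed

text \<open>
  In a walk starting at time \<open>0\<close>, coordinate \<open>j\<close> has been changed
  \<open>(i - j - 1) div k + 1\<close> times when time \<open>i\<close> is reached.
\<close>

definition coordinatewise :: "(nat \<Rightarrow> int \<Rightarrow> 'a \<Rightarrow> 'a) \<Rightarrow> int \<times> 'a list \<Rightarrow> int \<times> 'a list" where
  "coordinatewise h u =
     (fst u, map (\<lambda>j. h j ((fst u - int j - 1) div int k + 1) (snd u ! j)) [0..<k])"

text \<open>Along an arc at time \<open>i\<close> only the coordinate congruent to \<open>i\<close>
  changes, and its counter goes from some \<open>c\<close> to \<open>c + 1\<close>; this is where
  \<open>(h j c, h j (c + 1))\<close> must preserve arcs. Elsewhere the same injective map is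
  applied at both ends. During a time span \<open>q\<close> every counter grows by
  \<open>q div k\<close>, whence the period.\<close>

lemma equivariant_coordinatewise:
  assumes tf: "\<And>j c. j < k \<Longrightarrow> two_fold V E (h j c) (h j (c + 1))"
    and per: "\<And>j c. j < k \<Longrightarrow> h j (c + int (q div k)) = h j c"
  shows "equivariant_aut (coordinatewise h)"
proof -
  define b where "b = (\<lambda>i j. (i - int j - 1) div int k + 1)"
  have coord: "coordinatewise h u =
      (fst u, map (\<lambda>j. h j (b (fst u) j) (snd u ! j)) [0..<k])" for h u
    by (simp add: coordinatewise_def b_def)
  have bij: "bij_betw (h j c) V V" if "j < k" for j c
    using tf[OF that] by (simp add: two_fold_def)
  have h_in: "h j c x \<in> V" if "j < k" "x \<in> V" for j c x
    by (rule bij_betw_apply[OF bij[OF that(1)] that(2)])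
  have b_step: "b (i + 1) j = (if [int j = i] (mod int k) then b i j + 1 else b i j)" for i j
    using succ_div[of "int k" "i - int j - 1"] k
    by (simp add: b_def cong_iff_dvd_diff dvd_diff_commute[of "int k" "int j"] algebra_simps)
  have per': "h j (c + int (q div k) * m) = h j c" if "j < k" for j c m
  proof (induction m rule: int_induct[where k = 0])
    case (step1 m)
    then show ?case
      using per[OF that, of "c + int (q div k) * m"] by (simp add: algebra_simps)
  next
    case (step2 m)
    then show ?case
      using per[OF that, of "c + int (q div k) * (m - 1)"] by (simp add: algebra_simps)
  qed simp
  have b_shift: "b (i + int q * m) j = b i j + int (q div k) * m" for i m j
  proof -
    have "int q = int k * int (q div k)"
      using kq by (metis dvd_mult_div_cancel of_nat_mult)
    then have eq: "i + int q * m - int j - 1 = (i - int j - 1) + int k * (int (q div k) * m)"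
      by simp
    have "int k \<noteq> 0"
      using k by simp
    then show ?thesis
      unfolding b_def eq by (subst div_mult_self2) simp_all
  qed
  have periodic: "h j (b (i + int q * m) j) = h j (b i j)" if "j < k" for i j m
    by (simp only: b_shift per'[OF that])
  have "coordinatewise h ` orb u = orb (coordinatewise h u)" for u
  proof -
    have "coordinatewise h (fst u + int q * m, snd u) =
        (fst (coordinatewise h u) + int q * m, snd (coordinatewise h u))" for m
      using periodic by (simp add: coord)
    then show ?thesis
      by (simp add: orb_range image_image)
  qed
  moreover have "bij_betw (coordinatewise h) (pverts \<Gamma>) (pverts \<Gamma>)"
  \<comment> \<open>Times are left alone, so both maps read the same counters and can be inverted
    entry by entry.\<close>
  proof (rule bij_betw_byWitness[where f' = "coordinatewise (\<lambda>j c. inv_into V (h j c))"])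
    have i: "inv_into V (h j c) (h j c x) = x" "h j c (inv_into V (h j c) x) = x"
      "inv_into V (h j c) x \<in> V" if "j < k" "x \<in> V" for j c x
      using bij_betw_inv_into_left[OF bij[OF that(1)] that(2)]
        bij_betw_inv_into_right[OF bij[OF that(1)] that(2)]
        bij_betw_apply[OF bij_betw_inv_into[OF bij[OF that(1)]] that(2)]
      by simp_all
    then show "\<forall>u\<in>pverts \<Gamma>. coordinatewise (\<lambda>j c. inv_into V (h j c)) (coordinatewise h u) = u"
      "\<forall>u\<in>pverts \<Gamma>. coordinatewise h (coordinatewise (\<lambda>j c. inv_into V (h j c)) u) = u"
      by (auto simp: pverts_Z coord X_nth X_map h_in intro!: X_eqI)
    show "coordinatewise h ` pverts \<Gamma> \<subseteq> pverts \<Gamma>"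
      "coordinatewise (\<lambda>j c. inv_into V (h j c)) ` pverts \<Gamma> \<subseteq> pverts \<Gamma>"
      using i by (auto simp: pverts_Z coord X_nth X_map h_in)
  qed
  moreover have "(coordinatewise h u, coordinatewise h v) \<in> parcs \<Gamma> \<longleftrightarrow> (u, v) \<in> parcs \<Gamma>"
    if uv: "u \<in> pverts \<Gamma>" "v \<in> pverts \<Gamma>" for u v
  proof -
    obtain i x i' y where u: "u = (i, x)" "v = (i', y)" "x \<in> X" "y \<in> X"
      using uv by (auto simp: pverts_Z)
    have "(if [int j = i] (mod int k) then (x ! j, y ! j) \<in> E else x ! j = y ! j) \<longleftrightarrow>
        (if [int j = i] (mod int k) then (h j (b i j) (x ! j), h j (b (i + 1) j) (y ! j)) \<in> E
         else h j (b i j) (x ! j) = h j (b (i + 1) j) (y ! j))" if "j < k" for j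
      using that u X_nth two_fold_arc[OF tf[OF that]]
        inj_on_eq_iff[OF bij_betw_imp_inj_on[OF bij[OF that]]]
      by (simp add: b_step)
    then show ?thesis
      using u by (auto simp: arc_Z coord X_map h_in X_nth)
  qed
  ultimately show ?thesis
    by (simp add: equivariant_aut_def)
qed

subsection \<open>Transitivity on k-arcs\<close>

text \<open>From time 0 on, step \<open>m\<close> changes coordinate \<open>m\<close> and no other,
  so each coordinate changes once in \<open>k\<close> steps: it has its initial value up to its own
  step and its final value afterwards.\<close>

lemma k_arc_from_ends:
  assumes r: "r \<in> k_arcs k \<Gamma>" and r0: "fst (r ! 0) = 0"
  shows "j < k \<Longrightarrow> (snd (r ! 0) ! j, snd (r ! k) ! j) \<in> E"
    and "m \<le> k \<Longrightarrow> r ! m =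
      (int m, map (\<lambda>j. if j < m then snd (r ! k) ! j else snd (r ! 0) ! j) [0..<k])"
proof -
  have arc: "(r ! m, r ! Suc m) \<in> parcs \<Gamma>" if "m < k" for m
    using r that by (auto simp: k_arcs_def)
  have fst: "fst (r ! m) = int m" if "m \<le> k" for m
    using that
  proof (induction m)
    case (Suc m)
    then show ?case
      using arc[of m] by (simp add: arc_Z_pair)
  qed (use r0 in simp)
  have in_X: "snd (r ! m) \<in> X" if "m \<le> k" for m
  proof -
    have "r ! m \<in> pverts \<Gamma>"
      using r that by (auto simp: k_arcs_def)
    then show ?thesis by (auto simp: pverts_Z)
  qed
  have change: "if j = m then (snd (r ! m) ! j, snd (r ! Suc m) ! j) \<in> E
      else snd (r ! m) ! j = snd (r ! Suc m) ! j" if "m < k" "j < k" for m j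
  proof -
    have "[int j = int m] (mod int k) \<longleftrightarrow> j = m"
      using that by (simp add: cong_int_iff cong_def)
    then show ?thesis
      using arc[OF that(1)] fst[of m] that by (simp add: arc_Z_pair)
  qed
  have before: "snd (r ! m) ! j = snd (r ! 0) ! j" if "m \<le> j" "j < k" for m j
    using that
  proof (induction m)
    case (Suc m)
    then show ?case using change[of m j] by simp
  qed simp
  have after: "snd (r ! m) ! j = snd (r ! Suc j) ! j" if "Suc j \<le> m" "m \<le> k" for m j
    using that
  proof (induction m rule: dec_induct)
    case (step m)
    then show ?case using change[of m j] by simp
  qed simp
  show "(snd (r ! 0) ! j, snd (r ! k) ! j) \<in> E" if "j < k"
    using change[of j j] before[of j j] after[of j k] that by simp
  show "r ! m = (int m, map (\<lambda>j. if j < m then snd (r ! k) ! j else snd (r ! 0) ! j) [0..<k])"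
    if "m \<le> k"
  proof (rule prod_eqI)
    show "snd (r ! m) =
        snd (int m, map (\<lambda>j. if j < m then snd (r ! k) ! j else snd (r ! 0) ! j) [0..<k])"
      unfolding snd_conv
    proof (rule X_eqI)
      show "map (\<lambda>j. if j < m then snd (r ! k) ! j else snd (r ! 0) ! j) [0..<k] \<in> X"
        using in_X[of 0] in_X[of k] by (simp add: X_map X_nth)
      show "snd (r ! m) ! j =
          map (\<lambda>j. if j < m then snd (r ! k) ! j else snd (r ! 0) ! j) [0..<k] ! j" if "j < k" for j
        using before[of m j] after[of j m] after[of j k] that \<open>m \<le> k\<close> by simp
    qed (rule in_X[OF that])
  qed (use fst that in simp)
qed

text \<open>Lifted and shifted to time 0, a \<open>k\<close>-arc is one arc of
  \<open>\<Delta>\<close> for each coordinate, and \<open>fam\<close> is applied to every coordinate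
  separately: \<open>h 0\<close> moves the tail and \<open>h 1\<close> the head.\<close>

lemma k_arc_transitive_quotient:
  assumes fam: "\<And>v w v' w'. (v, w) \<in> E \<Longrightarrow> (v', w') \<in> E \<Longrightarrow>
    \<exists>h. (\<forall>c. two_fold V E (h c) (h (c + 1))) \<and> (\<forall>c. h (c + int (q div k)) = h c) \<and>
        h (0 :: int) v = v' \<and> h 1 w = w'"
  shows "k_arc_transitive k Q"
  unfolding k_arc_transitive_def
proof (intro ballI)
  have zero: "\<exists>F. equivariant_aut F \<and> map F r \<in> k_arcs k \<Gamma> \<and> fst (map F r ! 0) = 0"
    if r: "r \<in> k_arcs k \<Gamma>" for r
  proof -
    have r0: "r ! 0 \<in> pverts \<Gamma>" "0 < length r"
      using r by (auto simp: k_arcs_def)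
    obtain F where F: "equivariant_aut F" "\<forall>u\<in>pverts \<Gamma>. fst (F u) = fst u + (- fst (r ! 0))"
      using equivariant_translation by blast
    then show ?thesis
      using equivariant_aut_k_arc[OF F(1) r] r0 by auto
  qed
  have ends: "\<exists>H. equivariant_aut H \<and> map H r = r'"
    if r: "r \<in> k_arcs k \<Gamma>" "fst (r ! 0) = 0" and r': "r' \<in> k_arcs k \<Gamma>" "fst (r' ! 0) = 0" for r r'
  proof -
    have "\<exists>h. (\<forall>c. two_fold V E (h c) (h (c + 1))) \<and> (\<forall>c. h (c + int (q div k)) = h c) \<and>
        h (0 :: int) (snd (r ! 0) ! j) = snd (r' ! 0) ! j \<and>
        h 1 (snd (r ! k) ! j) = snd (r' ! k) ! j" if "j < k" for j
      by (rule fam[OF k_arc_from_ends(1)[OF r that] k_arc_from_ends(1)[OF r' that]])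
    then obtain h where h: "\<And>j c. j < k \<Longrightarrow> two_fold V E (h j c) (h j (c + 1))"
      "\<And>j c. j < k \<Longrightarrow> h j (c + int (q div k)) = h j c"
      "\<And>j. j < k \<Longrightarrow> h j (0 :: int) (snd (r ! 0) ! j) = snd (r' ! 0) ! j"
      "\<And>j. j < k \<Longrightarrow> h j 1 (snd (r ! k) ! j) = snd (r' ! k) ! j"
      by metis
    have b: "(int m - int j - 1) div int k + 1 = (if j < m then 1 else 0)"
      if "m \<le> k" "j < k" for m j
    proof (cases "j < m")
      case True
      then show ?thesis using that by (simp add: div_pos_pos_trivial)
    next
      case False
      \<comment> \<open>Here \<open>m \<le> j < k\<close> puts the numerator between
        \<open>- k\<close> and \<open>-1\<close>, so the quotient rounds down to \<open>-1\<close>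
        and the counter is 0.\<close>
      have "int m - int j - 1 = (int m - int j - 1 + int k) + int k * (-1)" by simp
      also have "\<dots> div int k = -1"
        using False that k by (subst div_mult_self2) (auto simp: div_pos_pos_trivial)
      finally show ?thesis using False by simp
    qed
    have "coordinatewise h (r ! m) = r' ! m" if "m \<le> k" for m
      unfolding k_arc_from_ends(2)[OF r that] k_arc_from_ends(2)[OF r' that]
      using that h b by (auto simp: coordinatewise_def)
    then have "map (coordinatewise h) r = r'"
      using r r' by (auto simp: k_arcs_def intro!: nth_equalityI)
    then show ?thesis
      using equivariant_coordinatewise[of h] h by blast
  qed
  fix p p' assume p: "p \<in> k_arcs k Q" and p': "p' \<in> k_arcs k Q"
  obtain r r' where r: "r \<in> k_arcs k \<Gamma>" "p = map orb r" "r' \<in> k_arcs k \<Gamma>" "p' = map orb r'"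
    using lift_k_arc p p' by metis
  obtain F F' where F: "equivariant_aut F" "map F r \<in> k_arcs k \<Gamma>" "fst (map F r ! 0) = 0"
    and F': "equivariant_aut F'" "map F' r' \<in> k_arcs k \<Gamma>" "fst (map F' r' ! 0) = 0"
    using zero r by metis
  obtain H where H: "equivariant_aut H" "map H (map F r) = map F' r'"
    using ends[OF F(2,3) F'(2,3)] by auto
  let ?G = "inv_into (pverts \<Gamma>) F'"
  have "map ?G (map F' r') = r'"
    using F'(1) r(3) by (auto simp: equivariant_aut_def k_arcs_def bij_betw_inv_into_left intro!: map_idI)
  then have eq: "map (?G \<circ> (H \<circ> F)) r = r'"
    using H(2) by (simp flip: map_map)
  obtain g where g: "g \<in> carrier (digraph_aut Q)"
    "\<forall>u\<in>pverts \<Gamma>. g (orb u) = orb ((?G \<circ> (H \<circ> F)) u)"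
    using equivariant_aut_Q[OF equivariant_aut_comp[OF equivariant_aut_comp[OF F(1) H(1)]
          equivariant_aut_inv[OF F'(1)]]] by blast
  have "map g p = map orb (map (?G \<circ> (H \<circ> F)) r)"
    using r(1) g(2) by (auto simp: r(2) k_arcs_def subset_iff)
  then show "\<exists>g\<in>carrier (digraph_aut Q). map g p = p'"
    using g(1) eq r(4) by metis
qed

subsection \<open>Failure of transitivity on longer arcs\<close>

text \<open>\<open>(j - i) mod k\<close> is the waiting time from time \<open>i\<close> until
  coordinate \<open>j\<close> is changed, and \<open>m \<le> k\<close> ensures that no coordinate is
  changed twice.\<close>

lemma relpow_Z:
  assumes "m \<le> k" "v \<in> X"
  shows "((i, v), (i', w)) \<in> parcs \<Gamma> ^^ m \<longleftrightarrow> w \<in> X \<and> i' = i + int m \<and>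
    (\<forall>j<k. if (int j - i) mod int k < int m then (v ! j, w ! j) \<in> E else v ! j = w ! j)"
  using assms(1)
proof (induction m arbitrary: i' w)
  case 0
  have "\<not> (int j - i) mod int k < 0" for j
    using k by (simp add: not_less)
  then show ?case
    using assms(2) by (auto intro: X_eqI)
next
  case (Suc m)
  have cong: "[int j = i + int m] (mod int k) \<longleftrightarrow> (int j - i) mod int k = int m" for j
  proof -
    have "[int j = i + int m] (mod int k) \<longleftrightarrow> [int j - i = int m] (mod int k)"
      by (simp add: cong_iff_dvd_diff algebra_simps)
    then show ?thesis
      using Suc.prems by (simp add: cong_def)
  qed
  have less: "a < int (Suc m) \<longleftrightarrow> a < int m \<or> a = int m" for a
    by auto
  show ?case
  proof
    assume "((i, v), (i', w)) \<in> parcs \<Gamma> ^^ Suc m"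
    then obtain i'' u where "((i, v), (i'', u)) \<in> parcs \<Gamma> ^^ m" "((i'', u), (i', w)) \<in> parcs \<Gamma>"
      by auto
    moreover have "((i, v), (i'', u)) \<in> parcs \<Gamma> ^^ m \<longleftrightarrow> u \<in> X \<and> i'' = i + int m \<and>
        (\<forall>j<k. if (int j - i) mod int k < int m then (v ! j, u ! j) \<in> E else v ! j = u ! j)"
      using Suc by simp
    ultimately show "w \<in> X \<and> i' = i + int (Suc m) \<and>
        (\<forall>j<k. if (int j - i) mod int k < int (Suc m) then (v ! j, w ! j) \<in> E else v ! j = w ! j)"
      unfolding less by (simp add: arc_Z cong) (metis less_irrefl)
  next
    assume R: "w \<in> X \<and> i' = i + int (Suc m) \<and>
        (\<forall>j<k. if (int j - i) mod int k < int (Suc m) then (v ! j, w ! j) \<in> E else v ! j = w ! j)"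
    \<comment> \<open>The state after \<open>m\<close> steps: coordinates changed by then already
      have their final values.\<close>
    define u where "u = map (\<lambda>j. if (int j - i) mod int k < int m then w ! j else v ! j) [0..<k]"
    have "u \<in> X"
      using R assms(2) by (simp add: u_def X_map X_nth)
    moreover have "((i, v), (i + int m, u)) \<in> parcs \<Gamma> ^^ m"
      using Suc R \<open>u \<in> X\<close> by (auto simp: u_def)
    moreover have "((i + int m, u), (i', w)) \<in> parcs \<Gamma>"
      using R \<open>u \<in> X\<close> by (auto simp: arc_Z cong u_def)
    ultimately show "((i, v), (i', w)) \<in> parcs \<Gamma> ^^ Suc m"
      by auto
  qed
qed

text \<open>
  The following property of the ends of a \<open>(k + 1)\<close>-arc starting at time \<open>0\<close>, whose first
  coordinate runs through \<open>v\<close>, \<open>w\<close>, \<open>u\<close>, says that every out-neighbour of \<open>v\<close> is an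
  in-neighbour of \<open>u\<close>.
\<close>

definition funnel :: "(int \<times> 'a list) set list \<Rightarrow> bool" where
  "funnel p \<longleftrightarrow> (\<forall>B. (p ! 0, B) \<in> parcs Q \<longrightarrow> (B, p ! Suc k) \<in> parcs Q ^^ k)"

lemma funnel_aut:
  assumes g: "g \<in> carrier (digraph_aut Q)" and p: "p \<in> k_arcs (Suc k) Q" and "funnel p"
  shows "funnel (map g p)"
  unfolding funnel_def
proof (intro allI impI)
  have pV: "p ! 0 \<in> pverts Q" "p ! Suc k \<in> pverts Q" and len: "length p = Suc (Suc k)"
    using p by (auto simp: k_arcs_def)
  have arc_in: "B \<in> pverts Q \<and> C \<in> pverts Q" if "(B, C) \<in> parcs Q" for B C
    using that by (simp add: quotient_digraph_def)
  have rel: "(g B, g C) \<in> parcs Q ^^ m" if "(B, C) \<in> parcs Q ^^ m" for B C m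
    using that
  proof (induction m arbitrary: C)
    case (Suc m)
    then obtain D where "(B, D) \<in> parcs Q ^^ m" "(D, C) \<in> parcs Q" by auto
    moreover from this have "(g D, g C) \<in> parcs Q"
      using aut_arc[OF g] arc_in by auto
    ultimately show ?case
      using Suc.IH by auto
  qed simp
  fix B assume B: "(map g p ! 0, B) \<in> parcs Q"
  then obtain C where C: "C \<in> pverts Q" "B = g C"
    using arc_in aut_bij[OF g] by (metis bij_betw_imp_surj_on imageE)
  then have "(p ! 0, C) \<in> parcs Q"
    using B len aut_arc[OF g pV(1)] by simp
  then show "(B, map g p ! Suc k) \<in> parcs Q ^^ k"
    using \<open>funnel p\<close> rel C len by (auto simp: funnel_def)
qed

text \<open>All coordinates start at \<open>v\<close>; coordinate 0 runs through
  \<open>v, w, u\<close> and the others through \<open>v, w\<close>. An out-neighbour of the start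
  has some \<open>y\<close> in coordinate 0, and \<open>k\<close> further steps must turn
  \<open>y\<close> into \<open>u\<close> and each other \<open>v\<close> into \<open>w\<close>. The
  latter is possible, so only the arc from \<open>y\<close> to \<open>u\<close> is at stake.\<close>

lemma two_arc_extends:
  assumes "(v, w) \<in> E" "(w, u) \<in> E"
  obtains p where "p \<in> k_arcs (Suc k) Q" "funnel p \<longleftrightarrow> (\<forall>y. (v, y) \<in> E \<longrightarrow> (y, u) \<in> E)"
proof -
  \<comment> \<open>Coordinate \<open>j\<close> turns into \<open>w\<close> at time
    \<open>j + 1\<close> and would turn into \<open>u\<close> at time \<open>j + k + 1\<close>; up
    to time \<open>k + 1\<close> the latter happens for \<open>j = 0\<close> only.\<close>
  define a where "a = (\<lambda>m. (int m, map (\<lambda>j. if m \<le> j then v else if m \<le> j + k then w else u) [0..<k]))"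
  define p where "p = map (\<lambda>m. orb (a m)) [0..<Suc (Suc k)]"
  have V: "v \<in> V" "w \<in> V" "u \<in> V"
    using assms arcs_wf by auto
  have a_in: "a m \<in> pverts \<Gamma>" for m
    using V by (simp add: a_def pverts_Z X_map)
  have arcs: "(a m, a (Suc m)) \<in> parcs \<Gamma>" if m: "m \<le> k" for m
  proof -
    have "[int j = int m] (mod int k) \<longleftrightarrow> j = m \<or> j = 0 \<and> m = k" if "j < k" for j
      using that m by (cases "m = k") (auto simp: cong_int_iff cong_def)
    then show ?thesis
      using m V assms by (auto simp: a_def arc_Z X_map)
  qed
  have "(orb (a m), orb (a (Suc m))) \<in> parcs Q" if "m \<le> k" for m
    using arc_Q[OF a_in] arcs[OF that] by blast
  then have "p \<in> k_arcs (Suc k) Q"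
    using a_in by (auto simp: p_def k_arcs_def pverts_Q simp del: upt_Suc)
  moreover have "funnel p \<longleftrightarrow> (\<forall>y. (v, y) \<in> E \<longrightarrow> (y, u) \<in> E)"
  proof -
    define a' where "a' = map (\<lambda>j. if j = 0 then u else w) [0..<k]"
    have a0: "a 0 = (0, map (\<lambda>j. v) [0..<k])"
      by (simp add: a_def)
    have ak: "a (Suc k) = (1 + int k, a')"
      by (auto simp: a_def a'_def)
    have "a' \<in> X"
      using V by (simp add: a'_def X_map)
    have path: "(orb (1, b), orb (a (Suc k))) \<in> parcs Q ^^ k \<longleftrightarrow> (\<forall>j<k. (b ! j, a' ! j) \<in> E)"
      if b: "b \<in> X" for b
    proof -
      have "(orb (1, b), orb (a (Suc k))) \<in> parcs Q ^^ k \<longleftrightarrow>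
          (\<exists>i x. x \<in> X \<and> ((1, b), (i, x)) \<in> parcs \<Gamma> ^^ k \<and> orb (1 + int k, a') = orb (i, x))"
        using relpow_Q[of "(1, b)" "orb (a (Suc k))" k] b by (auto simp: pverts_Z ak)
      \<comment> \<open>The length of the lifted walk fixes its final time and the orbit fixes its
        list, so passing to the quotient creates no new walk between these ends.\<close>
      also have "\<dots> \<longleftrightarrow> ((1, b), (1 + int k, a')) \<in> parcs \<Gamma> ^^ k"
      proof
        assume "\<exists>i x. x \<in> X \<and> ((1, b), (i, x)) \<in> parcs \<Gamma> ^^ k \<and> orb (1 + int k, a') = orb (i, x)"
        then obtain i x where ix: "((1, b), (i, x)) \<in> parcs \<Gamma> ^^ k"
          "orb (1 + int k, a') = orb (i, x)"
          by blast
        then have "i = 1 + int k" "x = a'"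
          using relpow_Z[OF order_refl b, of 1 i x] snd_orb_eq[OF ix(2)] by simp_all
        then show "((1, b), (1 + int k, a')) \<in> parcs \<Gamma> ^^ k"
          using ix(1) by simp
      qed (use \<open>a' \<in> X\<close> in blast)
      also have "\<dots> \<longleftrightarrow> (\<forall>j<k. (b ! j, a' ! j) \<in> E)"
        using relpow_Z[OF order_refl b] \<open>a' \<in> X\<close> k by simp
      finally show ?thesis .
    qed
    have out: "((0, map (\<lambda>j. v) [0..<k]), (i, b)) \<in> parcs \<Gamma> \<longleftrightarrow>
        i = 1 \<and> (\<exists>y. (v, y) \<in> E \<and> b = map (\<lambda>j. if j = 0 then y else v) [0..<k])" for i b
    proof -
      have "[int j = 0] (mod int k) \<longleftrightarrow> j = 0" if "j < k" for j
        using that by (simp add: cong_def)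
      then have "((0, map (\<lambda>j. v) [0..<k]), (i, b)) \<in> parcs \<Gamma> \<longleftrightarrow>
          b \<in> X \<and> i = 1 \<and> (v, b ! 0) \<in> E \<and> (\<forall>j<k. j \<noteq> 0 \<longrightarrow> b ! j = v)"
        using V k by (auto simp: arc_Z X_map)
      also have "\<dots> \<longleftrightarrow> i = 1 \<and> (\<exists>y. (v, y) \<in> E \<and> b = map (\<lambda>j. if j = 0 then y else v) [0..<k])"
      proof -
        have "b = map (\<lambda>j. if j = 0 then b ! 0 else v) [0..<k]"
          if "b \<in> X" "\<forall>j<k. j \<noteq> 0 \<longrightarrow> b ! j = v"
          using that V k by (intro X_eqI) (auto simp: X_map X_nth)
        then show ?thesis
          using V k arcs_wf by (auto simp: X_map)
      qed
      finally show ?thesis .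
    qed
    have ends: "p ! 0 = orb (a 0)" "p ! Suc k = orb (a (Suc k))"
      by (simp_all add: p_def del: upt_Suc)
    have out_Q: "(orb (a 0), B) \<in> parcs Q \<longleftrightarrow>
        (\<exists>y. (v, y) \<in> E \<and> B = orb (1, map (\<lambda>j. if j = 0 then y else v) [0..<k]))" for B
      using arc_Q[OF a_in[of 0], of B] unfolding split_paired_Ex a0 out by blast
    have "funnel p \<longleftrightarrow> (\<forall>y. (v, y) \<in> E \<longrightarrow>
        (orb (1, map (\<lambda>j. if j = 0 then y else v) [0..<k]), orb (a (Suc k))) \<in> parcs Q ^^ k)"
      unfolding funnel_def ends out_Q by blast
    also have "\<dots> \<longleftrightarrow> (\<forall>y. (v, y) \<in> E \<longrightarrow> (y, u) \<in> E)"
    proof -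
      have "(orb (1, map (\<lambda>j. if j = 0 then y else v) [0..<k]), orb (a (Suc k))) \<in> parcs Q ^^ k
          \<longleftrightarrow> (y, u) \<in> E" if "(v, y) \<in> E" for y
        using that V arcs_wf assms k by (subst path) (auto simp: X_map a'_def)
      then show ?thesis by auto
    qed
    finally show ?thesis .
  qed
  ultimately show thesis
    by (rule that)
qed

lemma not_Suc_k_arc_transitive_quotient:
  assumes "(v, w) \<in> E" "(w, u) \<in> E" "\<And>y. (v, y) \<in> E \<Longrightarrow> (y, u) \<in> E"
    and "(v', w') \<in> E" "(w', u') \<in> E" "(v', y') \<in> E" "(y', u') \<notin> E"
  shows "\<not> k_arc_transitive (Suc k) Q"
proof
  assume tr: "k_arc_transitive (Suc k) Q"
  obtain p where p: "p \<in> k_arcs (Suc k) Q" "funnel p"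
    using two_arc_extends[OF assms(1,2)] assms(3) by metis
  obtain p' where p': "p' \<in> k_arcs (Suc k) Q" "\<not> funnel p'"
    using two_arc_extends[OF assms(4,5)] assms(6,7) by metis
  then show False
    using tr p funnel_aut unfolding k_arc_transitive_def by metis
qed

end

section \<open>Automorphisms of the double half-cover\<close>

lemma connected_sym_rtrancl:
  assumes con: "Digraph_Component.connected (with_proj \<Delta>)" and sym: "sym (parcs \<Delta>)"
    and xy: "x \<in> pverts \<Delta>" "y \<in> pverts \<Delta>"
  shows "(x, y) \<in> (parcs \<Delta>)\<^sup>*"
proof -
  have E: "parcs (mk_symmetric (with_proj \<Delta>)) = parcs \<Delta>"
    using sym by (auto simp: parcs_mk_symmetric dest: symD)
  have "(x, y) \<in> rtrancl_on (pverts \<Delta>) (parcs \<Delta>)"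
    using con xy by (simp add: connected_def strongly_connected_def reachable_def E)
  then show ?thesis
    by induction (auto intro: rtrancl_into_rtrancl)
qed

lemma pverts_CDHC: "pverts (CDHC \<Delta>) = pverts \<Delta> \<times> {0, 1}"
  by (simp add: CDHC_def)

lemma arc_CDHC: "((x, i), (y, j)) \<in> parcs (CDHC \<Delta>) \<longleftrightarrow> i = 0 \<and> j = 1 \<and> (x, y) \<in> parcs \<Delta>"
  by (auto simp: CDHC_def)

text \<open>Every vertex of layer 0 is the tail of an arc, every vertex of layer 1 is a head, and
  none is both; so automorphisms preserve the layers.\<close>

lemma CDHC_aut_two_fold:
  assumes g: "g \<in> carrier (digraph_aut (CDHC \<Delta>))"
    and outgoing: "\<And>x. x \<in> pverts \<Delta> \<Longrightarrow> \<exists>y\<in>pverts \<Delta>. (x, y) \<in> parcs \<Delta>"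
    and incoming: "\<And>x. x \<in> pverts \<Delta> \<Longrightarrow> \<exists>y\<in>pverts \<Delta>. (y, x) \<in> parcs \<Delta>"
  shows "\<exists>f h. two_fold (pverts \<Delta>) (parcs \<Delta>) f h \<and>
    (\<forall>x\<in>pverts \<Delta>. g (x, 0) = (f x, 0) \<and> g (x, 1) = (h x, 1))"
proof -
  let ?V = "pverts \<Delta>" and ?E = "parcs \<Delta>"
  define f h where "f = (\<lambda>x. fst (g (x, 0)))" and "h = (\<lambda>x. fst (g (x, 1)))"
  have arc: "(g u, g v) \<in> parcs (CDHC \<Delta>) \<longleftrightarrow> (u, v) \<in> parcs (CDHC \<Delta>)"
    if "u \<in> ?V \<times> {0, 1}" "v \<in> ?V \<times> {0, 1}" for u v
    using aut_arc[OF g] that by (simp add: pverts_CDHC)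
  have sides: "i = 0 \<and> j = 1" if "((x, i), (y, j)) \<in> parcs (CDHC \<Delta>)" for x y :: 'a and i j
    using that by (simp add: arc_CDHC)
  have f: "g (x, 0) = (f x, 0)" if x: "x \<in> ?V" for x
  proof -
    obtain y where y: "y \<in> ?V" "(x, y) \<in> ?E"
      using outgoing[OF x] by blast
    then have "(g (x, 0), g (y, 1)) \<in> parcs (CDHC \<Delta>)"
      using x by (simp add: arc arc_CDHC)
    then have "snd (g (x, 0)) = 0"
      using sides by (metis prod.collapse)
    then show ?thesis
      by (simp add: f_def prod_eq_iff)
  qed
  have h: "g (x, 1) = (h x, 1)" if x: "x \<in> ?V" for x
  proof -
    obtain y where y: "y \<in> ?V" "(y, x) \<in> ?E"
      using incoming[OF x] by blast
    then have "(g (y, 0), g (x, 1)) \<in> parcs (CDHC \<Delta>)"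
      using x by (simp add: arc arc_CDHC)
    then have "snd (g (x, 1)) = 1"
      using sides by (metis prod.collapse)
    then show ?thesis
      by (simp add: h_def prod_eq_iff)
  qed
  have bij: "bij_betw g (?V \<times> {0, 1}) (?V \<times> {0, 1})"
    using aut_bij[OF g] by (simp add: pverts_CDHC)
  note inj = bij_betw_imp_inj_on[OF bij]
  have mem: "g u \<in> ?V \<times> {0, 1}" if "u \<in> ?V \<times> {0, 1}" for u
    using bij that by (rule bij_betw_apply)
  have surj: "\<exists>u\<in>?V \<times> {0, 1}. g u = v" if "v \<in> ?V \<times> {0, 1}" for v
  proof -
    have "v \<in> g ` (?V \<times> {0, 1})"
      using that by (simp only: bij_betw_imp_surj_on[OF bij])
    then show ?thesis
      by blast
  qed
  have "bij_betw f ?V ?V"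
    unfolding bij_betw_def
  proof (intro conjI equalityI subsetI inj_onI)
    fix x y assume "x \<in> ?V" "y \<in> ?V" "f x = f y"
    then show "x = y"
      using inj_onD[OF inj, of "(x, 0)" "(y, 0)"] f by simp
  next
    fix y assume "y \<in> f ` ?V"
    then show "y \<in> ?V"
      using mem f by fastforce
  next
    fix y assume "y \<in> ?V"
    then obtain x i where "x \<in> ?V" "i \<in> {0, 1}" "g (x, i) = (y, 0)"
      using surj[of "(y, 0)"] by auto
    then show "y \<in> f ` ?V"
      using f h by (cases "i = 0") auto
  qed
  moreover have "bij_betw h ?V ?V"
    unfolding bij_betw_def
  proof (intro conjI equalityI subsetI inj_onI)
    fix x y assume "x \<in> ?V" "y \<in> ?V" "h x = h y"
    then show "x = y"
      using inj_onD[OF inj, of "(x, 1)" "(y, 1)"] h by simp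
  next
    fix y assume "y \<in> h ` ?V"
    then show "y \<in> ?V"
      using mem h by fastforce
  next
    fix y assume "y \<in> ?V"
    then obtain x i where "x \<in> ?V" "i \<in> {0, 1}" "g (x, i) = (y, 1)"
      using surj[of "(y, 1)"] by auto
    then show "y \<in> h ` ?V"
      using f h by (cases "i = 0") auto
  qed
  moreover have "(x, y) \<in> ?E \<longleftrightarrow> (f x, h y) \<in> ?E" if "x \<in> ?V" "y \<in> ?V" for x y
    using arc[of "(x, 0)" "(y, 1)"] that f h by (simp add: arc_CDHC)
  ultimately have "two_fold ?V ?E f h"
    by (simp add: two_fold_def)
  then show ?thesis
    using f h by blast
qed

lemma two_fold_CDHC_aut:
  assumes tf: "two_fold (pverts \<Delta>) (parcs \<Delta>) f h"
  shows "restrict (\<lambda>(x, i). (if i = 0 then f x else h x, i)) (pverts (CDHC \<Delta>))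
    \<in> carrier (digraph_aut (CDHC \<Delta>))"
proof (rule restrict_aut)
  have bij: "bij_betw f (pverts \<Delta>) (pverts \<Delta>)" "bij_betw h (pverts \<Delta>) (pverts \<Delta>)"
    using tf by (auto simp: two_fold_def)
  have inv: "inv_into (pverts \<Delta>) f (f x) = x" "f (inv_into (pverts \<Delta>) f x) = x"
    "inv_into (pverts \<Delta>) h (h x) = x" "h (inv_into (pverts \<Delta>) h x) = x"
    if "x \<in> pverts \<Delta>" for x
    using that bij_betw_inv_into_left[OF bij(1)] bij_betw_inv_into_right[OF bij(1)]
      bij_betw_inv_into_left[OF bij(2)] bij_betw_inv_into_right[OF bij(2)] by blast+
  show "bij_betw (\<lambda>(x, i). (if i = 0 then f x else h x, i)) (pverts (CDHC \<Delta>)) (pverts (CDHC \<Delta>))"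
    by (rule bij_betw_byWitness[where f' = "\<lambda>(x, i). (if i = 0 then inv_into (pverts \<Delta>) f x
          else inv_into (pverts \<Delta>) h x, i)"])
      (use inv two_fold_in[OF tf] two_fold_in[OF two_fold_inv[OF tf]] in \<open>auto simp: pverts_CDHC\<close>)
next
  fix u v assume "u \<in> pverts (CDHC \<Delta>)" "v \<in> pverts (CDHC \<Delta>)"
  then show "(u, v) \<in> parcs (CDHC \<Delta>) \<longleftrightarrow>
      ((\<lambda>(x, i). (if i = 0 then f x else h x, i)) u, (\<lambda>(x, i). (if i = 0 then f x else h x, i)) v)
        \<in> parcs (CDHC \<Delta>)"
    using two_fold_arc[OF tf] by (auto simp: pverts_CDHC arc_CDHC)
qed

section \<open>The undirected stable case\<close>

lemma stable_symmetricI: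
  assumes wf: "pair_wf_digraph \<Delta>" and con: "Digraph_Component.connected (with_proj \<Delta>)"
    and st: "stable \<Delta>" and sym: "sym (parcs \<Delta>)" and tr: "arc_transitive (CDHC \<Delta>)"
    and br: "\<exists>x y z. y \<noteq> z \<and> (x, y) \<in> parcs \<Delta> \<and> (x, z) \<in> parcs \<Delta>"
  shows "stable_symmetric (pverts \<Delta>) (parcs \<Delta>)"
proof
  let ?V = "pverts \<Delta>" and ?E = "parcs \<Delta>"
  show EV: "?E \<subseteq> ?V \<times> ?V"
    using pair_wf_digraph.in_arcsD1[OF wf] pair_wf_digraph.in_arcsD2[OF wf] by auto
  show conn: "(x, y) \<in> ?E\<^sup>*" if "x \<in> ?V" "y \<in> ?V" for x y
    using connected_sym_rtrancl[OF con sym that] .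
  \<comment> \<open>Branching provides an arc \<open>(a, b)\<close>. A walk from \<open>a\<close> to
    \<open>x\<close> ends in an arc into \<open>x\<close> unless it is empty, and then
    \<open>(b, a)\<close> is such an arc.\<close>
  have incoming: "\<exists>y\<in>?V. (y, x) \<in> ?E" if x: "x \<in> ?V" for x
  proof -
    obtain a b where ab: "(a, b) \<in> ?E" "a \<in> ?V" "b \<in> ?V"
      using br EV by blast
    show ?thesis
      using conn[OF ab(2) x]
    proof (cases rule: rtranclE)
      case base
      then show ?thesis using ab sym by (auto dest: symD)
    next
      case (step y)
      then show ?thesis using EV by auto
    qed
  qed
  have outgoing: "\<exists>y\<in>?V. (x, y) \<in> ?E" if "x \<in> ?V" for x
    using incoming[OF that] sym by (meson symD)
  show "h x = x" if tf: "two_fold ?V ?E f h" and x: "x \<in> ?V" "f x = x" for f h x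
  proof -
    define g where "g = restrict (\<lambda>(x, i :: nat). (if i = 0 then f x else h x, i)) (pverts (CDHC \<Delta>))"
    have "g \<in> carrier (digraph_aut (CDHC \<Delta>))"
      unfolding g_def by (rule two_fold_CDHC_aut[OF tf])
    then have block: "g ` {(x, 0), (x, 1)} = {(x, 0), (x, 1)} \<or>
        {(x, 0), (x, 1)} \<inter> g ` {(x, 0), (x, 1)} = {}"
      using st x by (simp add: stable_def block_of_imprimitivity_def)
    have "g (x, 0) = (x, 0)" "g (x, 1) = (h x, 1)"
      using x by (auto simp: g_def pverts_CDHC)
    then show ?thesis
      using block by auto
  qed
  show "\<exists>f h. two_fold ?V ?E f h \<and> f v = v' \<and> h w = w'"
    if vw: "(v, w) \<in> ?E" "(v', w') \<in> ?E" for v w v' w'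
  proof -
    have V: "v \<in> ?V" "w \<in> ?V"
      using vw EV by auto
    have "[(x, 0), (y, 1)] \<in> k_arcs 1 (CDHC \<Delta>)" if "(x, y) \<in> ?E" for x y
      using that EV by (auto simp: k_arcs_def arc_CDHC pverts_CDHC)
    then obtain g where g: "g \<in> carrier (digraph_aut (CDHC \<Delta>))"
      "map g [(v, 0), (w, 1)] = [(v', 0), (w', 1)]"
      using tr vw unfolding k_arc_transitive_def by meson
    obtain f h where "two_fold ?V ?E f h" "\<forall>x\<in>?V. g (x, 0) = (f x, 0) \<and> g (x, 1) = (h x, 1)"
      using CDHC_aut_two_fold[OF g(1) outgoing incoming] by blast
    then show ?thesis
      using g(2) V by auto
  qed
qed (use sym br in auto)

lemma sharply_transitive_stable:
  assumes wf: "pair_wf_digraph \<Delta>" and con: "Digraph_Component.connected (with_proj \<Delta>)"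
    and st: "stable \<Delta>" and sym: "sym (parcs \<Delta>)" and tr: "arc_transitive (CDHC \<Delta>)"
    and br: "\<exists>x y z. y \<noteq> z \<and> (x, y) \<in> parcs \<Delta> \<and> (x, z) \<in> parcs \<Delta>"
    and k: "k > 0" "k dvd q"
  shows "sharply_k_arc_transitive k (quotient_digraph (Z_digraph \<Delta> k) (shift_power_group \<Delta> k q))"
proof -
  interpret S: stable_symmetric "pverts \<Delta>" "parcs \<Delta>"
    by (rule stable_symmetricI[OF assms(1-6)])
  interpret Z: Z_quotient \<Delta> k q
    using S.wf k by unfold_locales
  have "k_arc_transitive k Z.Q"
  proof (rule Z.k_arc_transitive_quotient)
    fix v w v' w' assume "(v, w) \<in> parcs \<Delta>" "(v', w') \<in> parcs \<Delta>"
    then obtain f where "two_fold (pverts \<Delta>) (parcs \<Delta>) f f" "f v = v'" "f w = w'"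
      by (rule S.diagonal_arc_transitive)
    then show "\<exists>h. (\<forall>c. two_fold (pverts \<Delta>) (parcs \<Delta>) (h c) (h (c + 1))) \<and>
        (\<forall>c. h (c + int (q div k)) = h c) \<and> h (0 :: int) v = v' \<and> h 1 w = w'"
      by (intro exI[of _ "\<lambda>_. f"]) auto
  qed
  moreover have "\<not> k_arc_transitive (Suc k) Z.Q"
  proof -
    obtain x y z where xyz: "y \<noteq> z" "(x, y) \<in> parcs \<Delta>" "(x, z) \<in> parcs \<Delta>"
      using br by auto
    have flip: "(b, a) \<in> parcs \<Delta>" if "(a, b) \<in> parcs \<Delta>" for a b
      using sym that by (rule symD)
    \<comment> \<open>The 2-arc \<open>x, y, x\<close> has the funnel property by symmetry. As
      \<open>y\<close> and \<open>z\<close> are not twins, one of them, \<open>y'\<close>, has a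
      neighbour \<open>t\<close> that is not adjacent to the other, \<open>z'\<close>; so
      \<open>y', x, z'\<close> lacks the property.\<close>
    have "parcs \<Delta> `` {y} \<noteq> parcs \<Delta> `` {z}"
      using S.twin_free S.arc_in xyz by metis
    then obtain y' z' t where "(x, y') \<in> parcs \<Delta>" "(x, z') \<in> parcs \<Delta>"
      "(y', t) \<in> parcs \<Delta>" "(z', t) \<notin> parcs \<Delta>"
      using xyz by blast
    then show ?thesis
      using Z.not_Suc_k_arc_transitive_quotient[of x y x y' x z' t] xyz flip by blast
  qed
  ultimately show ?thesis
    by (simp add: sharply_k_arc_transitive_def)
qed

section \<open>Cycles with loops\<close>

text \<open>The vertex of \<open>Theta n\<close> that represents an integer modulo \<open>n\<close>;
  the integer argument allows differences of vertices.\<close>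

definition residue :: "nat \<Rightarrow> int \<Rightarrow> nat" where
  "residue n a = nat (a mod int n)"

lemma int_residue: "n > 0 \<Longrightarrow> int (residue n a) = a mod int n"
  by (simp add: residue_def)

lemma residue_less: "n > 0 \<Longrightarrow> residue n a < n"
  by (simp add: residue_def nat_less_iff)

lemma residue_int: "x < n \<Longrightarrow> residue n (int x) = x"
  by (simp add: residue_def)

lemma residue_eq_iff: "n > 0 \<Longrightarrow> residue n a = residue n b \<longleftrightarrow> int n dvd a - b"
  by (simp add: residue_def eq_nat_nat_iff mod_eq_dvd_iff)

lemma residue_simps:
  assumes "n > 0"
  shows "residue n (int (residue n a) + b) = residue n (a + b)"
    and "residue n (int (residue n a) - b) = residue n (a - b)"
    and "residue n (b - int (residue n a)) = residue n (b - a)"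
  by (simp_all add: residue_def assms mod_simps)

lemma arc_Theta_residue:
  assumes "n > 0"
  shows "(residue n a, residue n b) \<in> parcs (Theta n) \<longleftrightarrow> int n dvd b - a \<or> int n dvd b - a - 1"
proof -
  have "(residue n a + 1) mod n = residue n (a + 1)"
  proof -
    have "int ((residue n a + 1) mod n) = (a + 1) mod int n"
      using assms by (simp add: zmod_int int_residue mod_add_right_eq add.commute)
    then show ?thesis
      by (simp add: residue_def)
  qed
  then show ?thesis
    using assms by (simp add: Theta_def residue_less residue_eq_iff algebra_simps)
qed

lemma Theta_rotation:
  assumes "n > 0"
  shows "two_fold (pverts (Theta n)) (parcs (Theta n))
    (\<lambda>x. residue n (int x + d)) (\<lambda>x. residue n (int x + d))"
proof -
  have "bij_betw (\<lambda>x. residue n (int x + d)) {0..<n} {0..<n}"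
    using assms
    by (intro bij_betw_byWitness[where f' = "\<lambda>x. residue n (int x - d)"])
      (auto simp: residue_less residue_int residue_simps)
  moreover have "(x, y) \<in> parcs (Theta n) \<longleftrightarrow>
      (residue n (int x + d), residue n (int y + d)) \<in> parcs (Theta n)" if "x < n" "y < n" for x y
    using arc_Theta_residue[OF assms, of "int x" "int y"] that
    by (simp add: residue_int arc_Theta_residue[OF assms])
  ultimately show ?thesis
    by (simp add: two_fold_def Theta_def)
qed

text \<open>Arcs have \<open>y - x\<close> equal to 0 or 1 modulo \<open>n\<close>, and
  \<open>(c + 1 - y) - (c - x) = 1 - (y - x)\<close> exchanges these values: loops become steps and
  conversely.\<close>

lemma Theta_reflection:
  assumes "n > 0"
  shows "two_fold (pverts (Theta n)) (parcs (Theta n))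
    (\<lambda>x. residue n (c - int x)) (\<lambda>x. residue n (c + 1 - int x))"
proof -
  have "bij_betw (\<lambda>x. residue n (a - int x)) {0..<n} {0..<n}" for a
    using assms
    by (intro bij_betw_byWitness[where f' = "\<lambda>x. residue n (a - int x)"])
      (auto simp: residue_less residue_int residue_simps)
  moreover have "(x, y) \<in> parcs (Theta n) \<longleftrightarrow>
      (residue n (c - int x), residue n (c + 1 - int y)) \<in> parcs (Theta n)" if "x < n" "y < n" for x y
  proof -
    have "int n dvd int x - int y \<longleftrightarrow> int n dvd int y - int x"
      "int n dvd 1 + int x - int y \<longleftrightarrow> int n dvd int y - int x - 1"
      using dvd_minus_iff[of "int n" "int y - int x"] dvd_minus_iff[of "int n" "int y - int x - 1"]
      by (simp_all add: algebra_simps)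
    then show ?thesis
      using arc_Theta_residue[OF assms, of "int x" "int y"] that
      by (auto simp: residue_int arc_Theta_residue[OF assms] algebra_simps)
  qed
  ultimately show ?thesis
    by (simp add: two_fold_def Theta_def)
qed

text \<open>Two loops, or two steps, are related by a rotation, taken as a constant family. A loop
  and a step need reflections, whose constant grows by 1 with every change; modulo \<open>n\<close>
  it returns after \<open>l\<close> changes because \<open>n dvd l\<close>.\<close>

lemma Theta_family:
  assumes n: "n > 0" and l: "n dvd l"
    and vw: "(v, w) \<in> parcs (Theta n)" and vw': "(v', w') \<in> parcs (Theta n)"
  shows "\<exists>h. (\<forall>c. two_fold (pverts (Theta n)) (parcs (Theta n)) (h c) (h (c + 1))) \<and>
    (\<forall>c. h (c + int l) = h c) \<and> h (0 :: int) v = v' \<and> h 1 w = w'"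
proof -
  have res: "(x + 1) mod n = residue n (int x + 1)" for x
    by (simp add: residue_def nat_mod_as_int add.commute)
  have small: "v < n" "v' < n"
    using vw vw' by (auto simp: Theta_def)
  have steps: "w = v \<or> w = residue n (int v + 1)" "w' = v' \<or> w' = residue n (int v' + 1)"
    using vw vw' by (auto simp: Theta_def simp flip: res)
  show ?thesis
  proof (cases "w = v \<longleftrightarrow> w' = v'")
    case True
    let ?f = "\<lambda>x. residue n (int x + (int v' - int v))"
    have "?f v = v'"
      using small by (simp add: residue_int)
    moreover have "?f w = w'"
    proof (cases "w = v")
      case False
      then have "w = residue n (int v + 1)" "w' = residue n (int v' + 1)"
        using steps True by auto
      then show ?thesis
        using residue_simps(1)[OF n, of "int v + 1" "int v' - int v"] by (simp add: add.commute)
    qed (use True \<open>?f v = v'\<close> in simp)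
    ultimately show ?thesis
      using Theta_rotation[OF n, of "int v' - int v"] by (intro exI[of _ "\<lambda>_. ?f"]) auto
  next
    case False
    \<comment> \<open>The summand \<open>v + v'\<close> makes \<open>h 0\<close> interchange
      \<open>v\<close> and \<open>v'\<close>.\<close>
    define h where "h = (\<lambda>(c :: int) x. residue n (c + (int v + int v') - int x))"
    have "two_fold (pverts (Theta n)) (parcs (Theta n)) (h c) (h (c + 1))" for c
      using Theta_reflection[OF n, of "c + (int v + int v')"] by (simp add: h_def algebra_simps)
    moreover have "h (c + int l) = h c" for c
      using n l by (auto simp: h_def residue_eq_iff algebra_simps)
    moreover have "h 0 v = v'"
      using small by (simp add: h_def residue_int)
    moreover have "h 1 w = w'"
    proof (cases "w = v")
      case True
      then have "w' = residue n (int v' + 1)"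
        using steps False by auto
      then show ?thesis
        using True by (simp add: h_def add.commute)
    next
      case w: False
      then have "w' = residue n (int v')" "w = residue n (int v + 1)"
        using steps False small by (auto simp: residue_int)
      then show ?thesis
        using n by (simp add: h_def residue_simps)
    qed
    ultimately show ?thesis
      by blast
  qed
qed

lemma sharply_transitive_Theta:
  assumes n: "n \<ge> 3" and k: "k > 0" and q: "k * n dvd q"
  shows "sharply_k_arc_transitive k
    (quotient_digraph (Z_digraph (Theta n) k) (shift_power_group (Theta n) k q))"
proof -
  have "k dvd q"
    using q by (rule dvd_mult_left)
  interpret Z: Z_quotient "Theta n" k q
    using k n \<open>k dvd q\<close> by unfold_locales (auto simp: Theta_def)
  have "n dvd q div k"
    using q k by (auto elim!: dvdE)
  then have "k_arc_transitive k Z.Q"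
    using n by (intro Z.k_arc_transitive_quotient Theta_family) auto
  moreover have "\<not> k_arc_transitive (Suc k) Z.Q"
  proof (rule Z.not_Suc_k_arc_transitive_quotient)
    \<comment> \<open>The out-neighbours 0 and 1 of 0 both have an arc to 1, so
      \<open>0, 0, 1\<close> has the funnel property; \<open>0, 0, 0\<close> lacks it, because for
      \<open>n \<ge> 3\<close> there is no arc from 1 to 0.\<close>
    show "(0, 0) \<in> parcs (Theta n)" "(0, 1) \<in> parcs (Theta n)"
      "(0, 0) \<in> parcs (Theta n)" "(0, 0) \<in> parcs (Theta n)"
      "(0, 1) \<in> parcs (Theta n)" "(1, 0) \<notin> parcs (Theta n)"
      "\<And>y. (0, y) \<in> parcs (Theta n) \<Longrightarrow> (y, 1) \<in> parcs (Theta n)"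
      using n by (auto simp: Theta_def)
  qed
  ultimately show ?thesis
    by (simp add: sharply_k_arc_transitive_def)
qed

text \<open>The branching condition excludes cases such as a single loop or a single undirected
  edge: with out-degrees at most 1, every \<open>k\<close>-arc has at most one continuation, and
  transitivity on \<open>k\<close>-arcs would extend to \<open>(k + 1)\<close>-arcs. Finiteness of
  the quotient requires finitely many vertices in \<open>\<Delta>\<close> and
  \<open>q > 0\<close>.\<close>

theorem theorem13:
  shows
    "(\<forall>(\<Delta> :: 'a pair_pre_digraph) k l q.
        pair_wf_digraph \<Delta> \<and> Digraph_Component.connected (with_proj \<Delta>) \<and> stable \<Delta> \<and> k \<ge> 1 \<and>
        sym (parcs \<Delta>) \<and> arc_transitive (CDHC \<Delta>) \<and>
        (\<exists>x y z. y \<noteq> z \<and> (x, y) \<in> parcs \<Delta> \<and> (x, z) \<in> parcs \<Delta>) \<and>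
        l > 1 \<and> q = l * k \<longrightarrow>
        (let Q = quotient_digraph (Z_digraph \<Delta> k) (shift_power_group \<Delta> k q) in
           pair_wf_digraph Q \<and> sharply_k_arc_transitive k Q \<and>
           (finite (pverts \<Delta>) \<longrightarrow> pair_fin_digraph Q))) \<and>
     (\<forall>n k q.
        n \<ge> 3 \<and> k \<ge> 1 \<and> q > 0 \<and> k * n dvd q \<longrightarrow>
        (let Q = quotient_digraph (Z_digraph (Theta n) k) (shift_power_group (Theta n) k q) in
           sharply_k_arc_transitive k Q \<and> pair_fin_digraph Q))"
  unfolding Let_def
proof (intro conjI allI impI; elim conjE)
  fix \<Delta> :: "'a pair_pre_digraph" and k l q :: nat
  assume a: "pair_wf_digraph \<Delta>" "Digraph_Component.connected (with_proj \<Delta>)" "stable \<Delta>"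
    "sym (parcs \<Delta>)" "arc_transitive (CDHC \<Delta>)"
    "\<exists>x y z. y \<noteq> z \<and> (x, y) \<in> parcs \<Delta> \<and> (x, z) \<in> parcs \<Delta>"
    and kq: "k \<ge> 1" "l > 1" "q = l * k"
  interpret Z: Z_quotient \<Delta> k q
    using kq pair_wf_digraph.in_arcsD1[OF a(1)] pair_wf_digraph.in_arcsD2[OF a(1)]
    by unfold_locales auto
  show "pair_wf_digraph Z.Q"
    by (rule Z.wf_Q)
  show "sharply_k_arc_transitive k Z.Q"
    using kq by (intro sharply_transitive_stable a) auto
  show "pair_fin_digraph Z.Q" if "finite (pverts \<Delta>)"
    using Z.finite_Q[OF that] kq by simp
next
  fix n k q :: nat
  assume n: "n \<ge> 3" "k \<ge> 1" "q > 0" "k * n dvd q"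
  then show "sharply_k_arc_transitive k
      (quotient_digraph (Z_digraph (Theta n) k) (shift_power_group (Theta n) k q))"
    by (intro sharply_transitive_Theta) auto
  interpret Z: Z_quotient "Theta n" k q
    using n dvd_mult_left[OF n(4)] by unfold_locales (auto simp: Theta_def)
  show "pair_fin_digraph Z.Q"
    using n by (intro Z.finite_Q) (auto simp: Theta_def)
qed

end
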